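(* Let $r$ be a positive integer, $p$ an odd prime, and $\lambda\in\mathbb{Z}_p$ with $F_r(\lambda)_{\frac{p-1}{2}}\not\equiv0\pmod p$. Then there is a $p$-adic unit $\alpha_r$ such that for all integers $s\ge1$ and all odd positive integers $m$, $$\frac{F_r(\lambda)_{\frac{mp^s-1}{2}}}{F_r(\lambda)_{\frac{mp^{s-1}-1}{2}}}\equiv\alpha_r\pmod{p^{s-d_m}},$$ where $d_m=\max_{s\ge0}\operatorname{ord}_p\big(F_r(\lambda)_{\frac{mp^s-1}{2}}\big)$. Moreover, the formal group with logarithm $\sum_{n\ge0}\frac{F_r(\lambda)_n}{2n+1}\tau^{2n+1}$ is isomorphic over $\mathbb{Z}_p$ to Stienstra's formal group $H^{r-1}(\mathcal{X}_r,\hat{G}_{m,\mathcal{X}_r})$ of the variety $\mathcal{X}_r(\lambda)$.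
   Context: $(a)_k=a(a+1)\cdots(a+k-1)$; $F_r(\lambda)_n:=\sum_{k=0}^{n}\left(\frac{(1/2)_k}{k!}\right)^r\lambda^k$. $\mathcal{X}_r(\lambda)$ is the variety $W^2=X_1X_2\cdots X_r(X_1-X_2)(X_2-X_3)\cdots(X_{r-1}-X_r)(X_r-\lambda X_1)$. Stienstra's formal group $H^{r-1}(\mathcal{X}_r,\hat G_{m,\mathcal{X}_r})$ is the one-dimensional formal group with logarithm $\sum_{n\ge0}\frac{b_{r,n}(\lambda)}{2n+1}\tau^{2n+1}$, where $b_{r,n}(\lambda)=\sum_{k=0}^{n}\frac{((-n)_k)^r}{(k!)^r}((-1)^r\lambda)^k$. $\operatorname{ord}_p$ is the $p$-adic valuation.
   Formalization: The coefficients b_{r,n} are taken from the variety's equation, giving sum ((-n)_k/k!)^r λ^k; the printed extra sign (-1)^{rk} is dropped, since for odd r it belongs to -λ and makes the isomorphism false (r=1, p=5, λ=2). *)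

theory Defs
  imports
    "Berlekamp_Zassenhaus.Finite_Field"
    "HOL-Computational_Algebra.Formal_Power_Series"
    "HOL-Computational_Algebra.Fraction_Field"
    "HOL-Library.Extended_Real"
    "HOL-Library.FuncSet"
    "HOL-Library.Poly_Mapping"
begin

text \<open>
  The prime is a type parameter: \<open>'p\<close> ranges over the types of prime cardinality, and
  \<open>p\<close> is \<open>CARD('p)\<close>. The \<open>p\<close>-adic integers are the inverse limit of the rings \<open>Z/p^n Z\<close>; the
  \<open>n\<close>-th entry of a sequence is the representative in \<open>{0..<p^n}\<close> of the class modulo \<open>p^n\<close>.
\<close>

typedef (overloaded) 'p padic_int =
  "{x :: nat \<Rightarrow> int. \<forall>n. x n \<in> {0..<int CARD('p::prime_card) ^ n} \<and>
      x (Suc n) mod int CARD('p) ^ n = x n}"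
  by (rule exI[of _ "\<lambda>_. 0"]) (simp add: prime_gt_0_nat[OF prime_card])

setup_lifting type_definition_padic_int

lemma CARD_prime_card_pos: "0 < CARD('p::prime_card)"
  by (rule prime_gt_0_nat[OF prime_card])

lemma power_CARD_pos: "0 < int CARD('p::prime_card) ^ n"
  using CARD_prime_card_pos[where 'p='p] by simp

lemma mod_power_Suc_mod: "(a mod int q ^ Suc n) mod int q ^ n = a mod int q ^ n"
  by (rule mod_mod_cancel) simp

lift_definition padic_int_of_int :: "int \<Rightarrow> 'p::prime_card padic_int"
  is "\<lambda>a n. a mod int CARD('p) ^ n"
  using power_CARD_pos[where 'p='p] by (simp only: mod_power_Suc_mod) simp

instantiation padic_int :: (prime_card) comm_ring_1
begin

lift_definition zero_padic_int :: "'a padic_int" is "\<lambda>_. 0"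
  using CARD_prime_card_pos[where 'p='a] by simp

lift_definition one_padic_int :: "'a padic_int" is "\<lambda>n. 1 mod int CARD('a) ^ n"
  using power_CARD_pos[where 'p='a] by (simp only: mod_power_Suc_mod) simp

lift_definition plus_padic_int :: "'a padic_int \<Rightarrow> 'a padic_int \<Rightarrow> 'a padic_int"
  is "\<lambda>x y n. (x n + y n) mod int CARD('a) ^ n"
proof -
  fix x y :: "nat \<Rightarrow> int" and n
  assume x: "\<And>n. x n \<in> {0..<int CARD('a) ^ n} \<and> x (Suc n) mod int CARD('a) ^ n = x n"
    and y: "\<And>n. y n \<in> {0..<int CARD('a) ^ n} \<and> y (Suc n) mod int CARD('a) ^ n = y n"
  have "(x (Suc n) + y (Suc n)) mod int CARD('a) ^ Suc n mod int CARD('a) ^ n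
      = (x (Suc n) mod int CARD('a) ^ n + y (Suc n) mod int CARD('a) ^ n) mod int CARD('a) ^ n"
    by (simp only: mod_power_Suc_mod mod_add_eq)
  then show "(x n + y n) mod int CARD('a) ^ n \<in> {0..<int CARD('a) ^ n} \<and>
      (x (Suc n) + y (Suc n)) mod int CARD('a) ^ Suc n mod int CARD('a) ^ n
        = (x n + y n) mod int CARD('a) ^ n"
    using x y power_CARD_pos[where 'p='a] by simp
qed

lift_definition uminus_padic_int :: "'a padic_int \<Rightarrow> 'a padic_int"
  is "\<lambda>x n. (- x n) mod int CARD('a) ^ n"
proof -
  fix x :: "nat \<Rightarrow> int" and n
  assume x: "\<And>n. x n \<in> {0..<int CARD('a) ^ n} \<and> x (Suc n) mod int CARD('a) ^ n = x n"
  have "(- x (Suc n)) mod int CARD('a) ^ Suc n mod int CARD('a) ^ n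
      = (- (x (Suc n) mod int CARD('a) ^ n)) mod int CARD('a) ^ n"
    by (simp only: mod_power_Suc_mod mod_minus_eq)
  then show "(- x n) mod int CARD('a) ^ n \<in> {0..<int CARD('a) ^ n} \<and>
      (- x (Suc n)) mod int CARD('a) ^ Suc n mod int CARD('a) ^ n
        = (- x n) mod int CARD('a) ^ n"
    using x power_CARD_pos[where 'p='a] by simp
qed

definition minus_padic_int :: "'a padic_int \<Rightarrow> 'a padic_int \<Rightarrow> 'a padic_int" where
  "minus_padic_int x y = x + (- y)"

lift_definition times_padic_int :: "'a padic_int \<Rightarrow> 'a padic_int \<Rightarrow> 'a padic_int"
  is "\<lambda>x y n. (x n * y n) mod int CARD('a) ^ n"
proof -
  fix x y :: "nat \<Rightarrow> int" and n
  assume x: "\<And>n. x n \<in> {0..<int CARD('a) ^ n} \<and> x (Suc n) mod int CARD('a) ^ n = x n"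
    and y: "\<And>n. y n \<in> {0..<int CARD('a) ^ n} \<and> y (Suc n) mod int CARD('a) ^ n = y n"
  have "(x (Suc n) * y (Suc n)) mod int CARD('a) ^ Suc n mod int CARD('a) ^ n
      = ((x (Suc n) mod int CARD('a) ^ n) * (y (Suc n) mod int CARD('a) ^ n)) mod int CARD('a) ^ n"
    by (simp only: mod_power_Suc_mod mod_mult_eq)
  then show "(x n * y n) mod int CARD('a) ^ n \<in> {0..<int CARD('a) ^ n} \<and>
      (x (Suc n) * y (Suc n)) mod int CARD('a) ^ Suc n mod int CARD('a) ^ n
        = (x n * y n) mod int CARD('a) ^ n"
    using x y power_CARD_pos[where 'p='a] by simp
qed

instance
proof
  fix a b c :: "'a padic_int"
  show "a * b * c = a * (b * c)"
    by transfer (simp add: fun_eq_iff mod_simps mult.assoc)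
  show "a * b = b * a"
    by transfer (simp add: fun_eq_iff mult.commute)
  show "1 * a = a"
    by transfer (simp add: fun_eq_iff mod_simps)
  show "a + b + c = a + (b + c)"
    by transfer (simp add: fun_eq_iff mod_simps add.assoc)
  show "a + b = b + a"
    by transfer (simp add: fun_eq_iff add.commute)
  show "0 + a = a"
    by transfer (simp add: fun_eq_iff mod_simps)
  show "- a + a = 0"
    by transfer (simp add: fun_eq_iff mod_simps)
  show "a - b = a + - b"
    by (rule minus_padic_int_def)
  show "(a + b) * c = a * c + b * c"
    by transfer (simp add: fun_eq_iff mod_simps distrib_right)
  have "1 mod int CARD('a) ^ 1 \<noteq> 0"
    using prime_gt_1_nat[OF prime_card[where 'a='a]] by simp
  then show "(0 :: 'a padic_int) \<noteq> 1"
    by transfer (metis (no_types))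
qed

end

lemma Rep_padic_int_mod_le:
  fixes x :: "'p::prime_card padic_int"
  assumes "m \<le> n"
  shows "Rep_padic_int x n mod int CARD('p) ^ m = Rep_padic_int x m"
  using assms
proof (induction n rule: dec_induct)
  case base
  show ?case using Rep_padic_int[of x] by simp
next
  case (step n)
  have "Rep_padic_int x (Suc n) mod int CARD('p) ^ m
      = Rep_padic_int x (Suc n) mod int CARD('p) ^ n mod int CARD('p) ^ m"
    using step.hyps by (simp add: le_imp_power_dvd mod_mod_cancel)
  then show ?case using Rep_padic_int[of x] step.IH by simp
qed

instance padic_int :: (prime_card) idom
proof
  fix x y :: "'a padic_int"
  let ?p = "int CARD('a)"
  assume "x \<noteq> 0" "y \<noteq> 0"
  then obtain a b where a: "Rep_padic_int x a \<noteq> 0" and b: "Rep_padic_int y b \<noteq> 0"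
    by (metis Rep_padic_int_inject zero_padic_int.rep_eq ext)
  have zero: "Rep_padic_int z 0 = 0" for z :: "'a padic_int"
    using Rep_padic_int[of z] by (auto dest: spec[of _ 0])
  from a b zero have "a > 0" "b > 0" by (metis gr0I)+
  have xa: "\<not> ?p ^ a dvd Rep_padic_int x (a + b)"
    using a Rep_padic_int_mod_le[of a "a + b" x] by (simp add: dvd_eq_mod_eq_0)
  have yb: "\<not> ?p ^ b dvd Rep_padic_int y (a + b)"
    using b Rep_padic_int_mod_le[of b "a + b" y] by (simp add: dvd_eq_mod_eq_0)
  have "\<not> ?p ^ (a + b - 1) dvd Rep_padic_int x (a + b) * Rep_padic_int y (a + b)"
  proof
    assume "?p ^ (a + b - 1) dvd Rep_padic_int x (a + b) * Rep_padic_int y (a + b)"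
    moreover have "a + b = Suc (a + b - 1)" using \<open>a > 0\<close> by simp
    moreover have "prime_elem ?p" using prime_card_int[where 'a='a] by blast
    ultimately show False
      using xa yb prime_elem_power_dvd_cases by blast
  qed
  then have "\<not> ?p ^ (a + b) dvd Rep_padic_int x (a + b) * Rep_padic_int y (a + b)"
    by (meson diff_le_self dvd_trans le_imp_power_dvd)
  then have "Rep_padic_int (x * y) (a + b) \<noteq> Rep_padic_int 0 (a + b)"
    by (simp add: times_padic_int.rep_eq zero_padic_int.rep_eq dvd_eq_mod_eq_0)
  then show "x * y \<noteq> 0" by metis
qed

lemma Rep_padic_int_of_nat:
  "Rep_padic_int (of_nat k :: 'p::prime_card padic_int) n = int k mod int CARD('p) ^ n"
  by (induction k)
    (simp_all add: zero_padic_int.rep_eq one_padic_int.rep_eq plus_padic_int.rep_eq mod_simps)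

instance padic_int :: (prime_card) ring_char_0
proof
  show "inj (of_nat :: nat \<Rightarrow> 'a padic_int)"
  proof (rule injI)
    fix k l assume eq: "(of_nat k :: 'a padic_int) = of_nat l"
    have lt: "j < CARD('a) ^ (k + l)" if "j \<le> k + l" for j
    proof -
      have "k + l < CARD('a) ^ (k + l)"
        using prime_gt_1_nat[OF prime_card[where 'a='a]] by (simp add: power_gt_expt)
      with that show ?thesis by simp
    qed
    have "int k mod int (CARD('a) ^ (k + l)) = int l mod int (CARD('a) ^ (k + l))"
      using arg_cong[OF eq, of "\<lambda>x. Rep_padic_int x (k + l)"]
      by (simp add: Rep_padic_int_of_nat)
    then show "k = l"
      using lt[of k] lt[of l] by (simp flip: zmod_int)
  qed
qed

instance fract :: ("{idom, ring_char_0}") field_char_0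
proof
  show "inj (of_nat :: nat \<Rightarrow> 'a fract)"
    by (rule injI) (simp add: of_nat_fract eq_fract)
qed

type_synonym 'p padic = "'p padic_int fract"

definition of_padic_int :: "'p::prime_card padic_int \<Rightarrow> 'p padic" where
  "of_padic_int x = Fract x 1"

text \<open>
  \<open>padic_ord x\<close> is the supremum of all \<open>e\<close> with \<open>x \<in> p^e Z_p\<close>; in particular
  \<open>padic_ord 0 = \<infinity>\<close>. The modulus \<open>p^e\<close> of a congruence may have a negative exponent, and
  \<open>e = -\<infinity>\<close> imposes no condition.
\<close>

definition padic_ord :: "'p::prime_card padic \<Rightarrow> ereal" where
  "padic_ord x =
     (SUP e \<in> {e :: int. \<exists>z. x = of_nat CARD('p) powi e * of_padic_int z}. ereal (real_of_int e))"

definition padic_cong :: "'p::prime_card padic \<Rightarrow> 'p padic \<Rightarrow> ereal \<Rightarrow> bool" where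
  "padic_cong x y e \<longleftrightarrow> e \<le> padic_ord (x - y)"

text \<open>
  A power series \<open>G(x,y)\<close> is an element of \<open>'a fps fps\<close>, the inner variable being \<open>x\<close> and the
  outer one \<open>y\<close>.
\<close>

definition coeff2 :: "'a fps fps \<Rightarrow> nat \<Rightarrow> nat \<Rightarrow> 'a" where
  "coeff2 G i j = fps_nth (fps_nth G j) i"

definition fps2 :: "(nat \<Rightarrow> nat \<Rightarrow> 'a) \<Rightarrow> 'a fps fps" where
  "fps2 c = Abs_fps (\<lambda>j. Abs_fps (\<lambda>i. c i j))"

text \<open>
  The series \<open>f(G(x,y))\<close>, for \<open>G\<close> without constant term: then \<open>G^k\<close> has no terms of total
  degree less than \<open>k\<close>, so only \<open>k \<le> i + j\<close> contribute to the coefficient of \<open>x^i y^j\<close>.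
  (The library composition on \<open>'a fps fps\<close> is in the outer variable only.)
\<close>

definition compose_outer2 :: "'a::comm_ring_1 fps \<Rightarrow> 'a fps fps \<Rightarrow> 'a fps fps" where
  "compose_outer2 f G = fps2 (\<lambda>i j. \<Sum>k\<le>i + j. fps_nth f k * coeff2 (G ^ k) i j)"

text \<open>The series \<open>G(\<phi>(x), \<phi>(y))\<close>, for \<open>\<phi>\<close> without constant term.\<close>

definition compose_inner2 :: "'a::comm_ring_1 fps fps \<Rightarrow> 'a fps \<Rightarrow> 'a fps fps" where
  "compose_inner2 G \<phi> =
     fps2 (\<lambda>i j. \<Sum>a\<le>i. \<Sum>b\<le>j. coeff2 G a b * fps_nth (\<phi> ^ a) i * fps_nth (\<phi> ^ b) j)"

text \<open>
  In the associativity law \<open>G(G(x,y),z) = G(x,G(y,z))\<close>, write \<open>G = \<Sum>\<^sub>l A\<^sub>l(x) y^l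
  = \<Sum>\<^sub>i x^i B\<^sub>i(y)\<close>. The coefficient of \<open>x^i y^j z^l\<close> is that of \<open>x^i y^j\<close> in
  \<open>A\<^sub>l(G(x,y))\<close> on the left, and that of \<open>y^j z^l\<close> in \<open>B\<^sub>i(G(y,z))\<close> on the right.
\<close>

definition formal_group_law :: "'a::comm_ring_1 fps fps \<Rightarrow> bool" where
  "formal_group_law G \<longleftrightarrow>
     (\<forall>i. coeff2 G i 0 = fps_nth fps_X i) \<and>
     (\<forall>j. coeff2 G 0 j = fps_nth fps_X j) \<and>
     (\<forall>i j. coeff2 G i j = coeff2 G j i) \<and>
     (\<forall>i j l. coeff2 (compose_outer2 (Abs_fps (\<lambda>a. coeff2 G a l)) G) i j
            = coeff2 (compose_outer2 (Abs_fps (\<lambda>b. coeff2 G i b)) G) j l)"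

definition formal_group_hom :: "'a::comm_ring_1 fps fps \<Rightarrow> 'a fps fps \<Rightarrow> 'a fps \<Rightarrow> bool" where
  "formal_group_hom G H \<phi> \<longleftrightarrow>
     fps_nth \<phi> 0 = 0 \<and> compose_outer2 \<phi> G = compose_inner2 H \<phi>"

definition formal_group_isomorphic :: "'a::comm_ring_1 fps fps \<Rightarrow> 'a fps fps \<Rightarrow> bool" where
  "formal_group_isomorphic G H \<longleftrightarrow>
     (\<exists>\<phi> \<psi>. formal_group_hom G H \<phi> \<and> formal_group_hom H G \<psi> \<and>
        fps_compose \<phi> \<psi> = fps_X \<and> fps_compose \<psi> \<phi> = fps_X)"

text \<open>
  \<open>l\<close> is the logarithm of \<open>G\<close>: \<open>l(\<tau>) = \<tau> + \<dots>\<close> and \<open>l(G(x,y)) = l(x) + l(y)\<close>. Here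
  \<open>G\<close> has coefficients in \<open>Z_p\<close> and \<open>l\<close> has coefficients in \<open>Q_p\<close>. For given \<open>l\<close> there is at
  most one formal group law \<open>G\<close> with this property.
\<close>

definition formal_group_log :: "'p::prime_card padic_int fps fps \<Rightarrow> 'p padic fps \<Rightarrow> bool" where
  "formal_group_log G l \<longleftrightarrow>
     fps_nth l 0 = 0 \<and> fps_nth l 1 = 1 \<and>
     compose_outer2 l (fps2 (\<lambda>i j. of_padic_int (coeff2 G i j))) =
       fps2 (\<lambda>i j. (if j = 0 then fps_nth l i else 0) + (if i = 0 then fps_nth l j else 0))"

text \<open>The series \<open>\<Sum>\<^sub>n c\<^sub>n \<tau>^(2n+1) / (2n+1)\<close>.\<close>

definition odd_log_series :: "(nat \<Rightarrow> 'a::field_char_0) \<Rightarrow> 'a fps" where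
  "odd_log_series c = Abs_fps (\<lambda>k. if odd k then c (k div 2) / of_nat k else 0)"

definition F_trunc :: "nat \<Rightarrow> 'a::field_char_0 \<Rightarrow> nat \<Rightarrow> 'a" where
  "F_trunc r lam n = (\<Sum>k\<le>n. (pochhammer (1 / 2) k / fact k) ^ r * lam ^ k)"

type_synonym 'a mpoly = "(nat \<Rightarrow>\<^sub>0 nat) \<Rightarrow>\<^sub>0 'a"

definition Var :: "nat \<Rightarrow> 'a::comm_ring_1 mpoly" where
  "Var i = Poly_Mapping.single (Poly_Mapping.single i 1) 1"

definition Const :: "'a::comm_ring_1 \<Rightarrow> 'a mpoly" where
  "Const c = Poly_Mapping.single 0 c"

text \<open>The variety \<open>\<X>_r(\<lambda>)\<close> is the double cover \<open>W^2 = branch_poly r \<lambda>\<close> of projective space.\<close>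

definition branch_poly :: "nat \<Rightarrow> 'a::comm_ring_1 \<Rightarrow> 'a mpoly" where
  "branch_poly r lam =
     (\<Prod>i=1..r. Var i) * (\<Prod>i=1..<r. Var i - Var (i + 1)) * (Var r - Const lam * Var 1)"

text \<open>
  Stienstra's theorem: for \<open>P\<close> homogeneous of degree \<open>2r\<close> in \<open>X_1, \<dots>, X_r\<close>, the formal group
  \<open>H^(r-1)(\<X>, G_m)\<close> of the double cover \<open>\<X>: W^2 = P\<close> is the one-dimensional formal group with
  logarithm \<open>\<Sum>\<^sub>n b\<^sub>n \<tau>^(2n+1) / (2n+1)\<close>, where \<open>b\<^sub>n\<close> is the coefficient of
  \<open>(X_1 \<cdots> X_r)^(2n)\<close> in \<open>P^n\<close>.
\<close>

definition stienstra_coeff :: "nat \<Rightarrow> 'a::comm_ring_1 \<Rightarrow> nat \<Rightarrow> 'a" where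
  "stienstra_coeff r lam n =
     Poly_Mapping.lookup (branch_poly r lam ^ n) (\<Sum>i=1..r. Poly_Mapping.single i (2 * n))"

lemma prod_single:
  "finite I \<Longrightarrow> (\<Prod>i\<in>I. Poly_Mapping.single (e i) (c i :: 'a::comm_ring_1)) =
     Poly_Mapping.single (\<Sum>i\<in>I. e i :: nat \<Rightarrow>\<^sub>0 nat) (\<Prod>i\<in>I. c i)"
  by (induction I rule: finite_induct) (simp_all add: mult_single)

lemma single_power:
  "Poly_Mapping.single e (c :: 'a::comm_ring_1) ^ n =
     Poly_Mapping.single (of_nat n * e :: nat \<Rightarrow>\<^sub>0 nat) (c ^ n)"
  by (induction n) (simp_all add: mult_single algebra_simps)

lemma of_nat_times_single:
  "(of_nat n :: nat \<Rightarrow>\<^sub>0 nat) * Poly_Mapping.single i k = Poly_Mapping.single i (n * k)"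
  by (induction n) (simp_all add: distrib_right flip: single_add)

text \<open>
  The coefficients in closed form. With \<open>(n choose k)^r\<close> the \<open>k\<close>-th power is that of
  \<open>(-1)^r \<lambda>\<close>; with \<open>((-n)_k / k!)^r\<close> it is that of \<open>\<lambda>\<close> itself.
\<close>

lemma stienstra_coeff_binomial:
  assumes r: "r \<ge> 1"
  shows "stienstra_coeff r (lam :: 'a::comm_ring_1) n =
           (\<Sum>k\<le>n. of_nat (n choose k) ^ r * ((- 1) ^ r * lam) ^ k)"
proof -
  let ?I = "{1..r}"
  let ?single = "Poly_Mapping.single"
  define nxt where "nxt i = (if i = r then 1 else i + 1)" for i
  define c where "c i = (if i = r then lam else 1)" for i
  define e :: "nat \<Rightarrow> nat \<Rightarrow> nat \<Rightarrow>\<^sub>0 nat"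
    where "e i k = ?single i (2 * n - k) + ?single (nxt i) k" for i k
  define a where "a i k = of_nat (n choose k) * (- c i) ^ k" for i k
  have I: "?I = insert r {1..<r}" using r by auto
  have factor: "(Var i * (Var i - Const (c i) * Var (nxt i))) ^ n = (\<Sum>k\<le>n. ?single (e i k) (a i k))"
    (is "?lhs = _") for i
  proof -
    have lin: "Var i - Const (c i) * Var (nxt i) = ?single (?single (nxt i) 1) (- c i) + Var i"
      by (simp add: Var_def Const_def mult_single single_uminus)
    have "?lhs = (\<Sum>k\<le>n. Var i ^ n * (of_nat (n choose k) *
        ?single (?single (nxt i) 1) (- c i) ^ k * Var i ^ (n - k)))"
      unfolding power_mult_distrib lin binomial_ring sum_distrib_left ..
    also have "\<dots> = (\<Sum>k\<le>n. ?single (e i k) (a i k))"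
    proof (rule sum.cong)
      fix k assume "k \<in> {..n}"
      then have k: "n + (n - k) = 2 * n - k" by simp
      have "Var i ^ n * (of_nat (n choose k) *
          ?single (?single (nxt i) 1) (- c i) ^ k * Var i ^ (n - k))
        = of_nat (n choose k) * ?single (?single (nxt i) 1) (- c i) ^ k * (Var i ^ (n + (n - k)) :: 'a mpoly)"
        by (simp add: power_add algebra_simps)
      also have "\<dots> = ?single (e i k) (a i k)"
        unfolding k
        unfolding Var_def single_power of_nat_times_single single_of_nat[symmetric] mult_single
          e_def a_def
        by (simp add: add.commute del: single_of_nat)
      finally show "Var i ^ n * (of_nat (n choose k) *
          ?single (?single (nxt i) 1) (- c i) ^ k * Var i ^ (n - k)) = ?single (e i k) (a i k)" .
    qed simp
    finally show ?thesis .
  qed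
  have "branch_poly r lam = (\<Prod>i\<in>?I. Var i * (Var i - Const (c i) * Var (nxt i)))"
  proof -
    have "(\<Prod>i=1..<r. Var i - Const (c i) * Var (nxt i)) = (\<Prod>i=1..<r. Var i - Var (i + 1) :: 'a mpoly)"
      by (rule prod.cong) (simp_all add: c_def nxt_def Const_def)
    then show ?thesis
      unfolding branch_poly_def prod.distrib
      by (subst (3) I) (simp add: c_def nxt_def algebra_simps)
  qed
  then have "branch_poly r lam ^ n = (\<Prod>i\<in>?I. \<Sum>k\<le>n. ?single (e i k) (a i k))"
    by (simp only: prod_power_distrib factor)
  also have "\<dots> = (\<Sum>f\<in>?I \<rightarrow>\<^sub>E {..n}. \<Prod>i\<in>?I. ?single (e i (f i)) (a i (f i)))"
    by (rule prod_sum_PiE) simp_all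
  also have "\<dots> = (\<Sum>f\<in>?I \<rightarrow>\<^sub>E {..n}. ?single (\<Sum>i\<in>?I. e i (f i)) (\<Prod>i\<in>?I. a i (f i)))"
    by (simp add: prod_single)
  finally have pow: "branch_poly r lam ^ n = \<dots>" .
  define t where "t = (\<Sum>i\<in>?I. ?single i (2 * n))"
  define con where "con k = (\<lambda>i. if i \<in> ?I then k else undefined)" for k :: nat
  have nxt_bij: "bij_betw nxt ?I ?I"
    by (rule bij_betw_byWitness[where f' = "\<lambda>j. if j = 1 then r else j - 1"])
      (use r in \<open>auto simp: nxt_def\<close>)
  have iff: "(\<Sum>i\<in>?I. e i (f i)) = t \<longleftrightarrow> f \<in> con ` {..n}" if f: "f \<in> ?I \<rightarrow>\<^sub>E {..n}" for f
  proof
    assume eq: "(\<Sum>i\<in>?I. e i (f i)) = t"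
    have step: "f (Suc j) = f j" if j: "1 \<le> j" "Suc j \<le> r" for j
    proof -
      have "Poly_Mapping.lookup (\<Sum>i\<in>?I. e i (f i)) (Suc j)
          = (\<Sum>i\<in>?I. (if i = Suc j then 2 * n - f i else 0) + (if i = j then f i else 0))"
        unfolding lookup_sum e_def lookup_add lookup_single when_def
        by (rule sum.cong) (use j in \<open>auto simp: nxt_def\<close>)
      also have "\<dots> = (2 * n - f (Suc j)) + f j"
        using j by (simp add: sum.distrib)
      also have "Poly_Mapping.lookup (\<Sum>i\<in>?I. e i (f i)) (Suc j) = 2 * n"
        unfolding eq t_def lookup_sum lookup_single when_def using j by simp
      moreover have "f (Suc j) \<le> n" using f j by (auto simp: PiE_iff)
      ultimately show ?thesis by simp
    qed
    have const: "f j = f 1" if "1 \<le> j" "j \<le> r" for j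
      using that by (induction j rule: nat_induct_at_least) (use step in auto)
    have "f = con (f 1)"
    proof
      fix j
      show "f j = con (f 1) j"
        unfolding con_def using PiE_arb[OF f, of j] const[of j]
        by (cases "j \<in> ?I") (metis atLeastAtMost_iff)+
    qed
    moreover have "f 1 \<le> n" using f r by (auto simp: PiE_iff)
    ultimately show "f \<in> con ` {..n}" by blast
  next
    assume "f \<in> con ` {..n}"
    then obtain k where k: "k \<le> n" "f = con k" by auto
    have "(\<Sum>i\<in>?I. e i (f i)) = (\<Sum>i\<in>?I. ?single i (2 * n - k)) + (\<Sum>i\<in>?I. ?single (nxt i) k)"
      unfolding e_def sum.distrib using k by (simp add: con_def)
    also have "(\<Sum>i\<in>?I. ?single (nxt i) k) = (\<Sum>i\<in>?I. ?single i k)"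
      by (rule sum.reindex_bij_betw[OF nxt_bij])
    also have "(\<Sum>i\<in>?I. ?single i (2 * n - k)) + (\<Sum>i\<in>?I. ?single i k) = t"
      unfolding t_def sum.distrib[symmetric] using k by (simp flip: single_add)
    finally show "(\<Sum>i\<in>?I. e i (f i)) = t" .
  qed
  have con_sub: "con ` {..n} \<subseteq> ?I \<rightarrow>\<^sub>E {..n}" by (auto simp: con_def PiE_iff extensional_def)
  have inj: "inj_on con {..n}"
    by (rule inj_onI) (use r in \<open>auto simp: con_def fun_eq_iff dest: spec[of _ 1] split: if_splits\<close>)
  have "stienstra_coeff r lam n
      = (\<Sum>f\<in>?I \<rightarrow>\<^sub>E {..n}. (\<Prod>i\<in>?I. a i (f i)) when (\<Sum>i\<in>?I. e i (f i)) = t)"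
    unfolding stienstra_coeff_def pow lookup_sum lookup_single t_def ..
  also have "\<dots> = (\<Sum>f\<in>con ` {..n}. \<Prod>i\<in>?I. a i (f i))"
    by (rule sum.mono_neutral_cong_right)
      (use iff con_sub in \<open>auto intro!: finite_PiE simp: when_def subset_eq\<close>)
  also have "\<dots> = (\<Sum>k\<le>n. \<Prod>i\<in>?I. a i k)"
    by (subst sum.reindex[OF inj]) (simp add: con_def)
  also have "\<dots> = (\<Sum>k\<le>n. of_nat (n choose k) ^ r * ((- 1) ^ r * lam) ^ k)"
  proof (rule sum.cong)
    fix k
    have "(\<Prod>i\<in>?I. - c i) = (- 1) ^ r * lam"
      using r by (simp add: prod_uminus c_def)
    then show "(\<Prod>i\<in>?I. a i k) = of_nat (n choose k) ^ r * ((- 1) ^ r * lam) ^ k"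
      unfolding a_def prod.distrib by (simp flip: prod_power_distrib)
  qed simp
  finally show ?thesis .
qed

lemma stienstra_coeff_pochhammer:
  assumes "r \<ge> 1"
  shows "stienstra_coeff r (lam :: 'a::field_char_0) n =
           (\<Sum>k\<le>n. pochhammer (- of_nat n) k ^ r / fact k ^ r * lam ^ k)"
proof -
  have "(of_nat (n choose k) ^ r * ((- 1) ^ r * lam) ^ k :: 'a) =
      pochhammer (- of_nat n) k ^ r / fact k ^ r * lam ^ k" for k
  proof -
    have "(of_nat (n choose k) :: 'a) = (- 1) ^ k * (pochhammer (- of_nat n) k / fact k)"
      by (simp add: binomial_gbinomial gbinomial_pochhammer)
    moreover have "((- 1) ^ k) ^ r * ((- 1) ^ r) ^ k = (1 :: 'a)"
      by (simp add: mult.commute[of r k] flip: power_mult power_mult_distrib)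
    ultimately show ?thesis
      by (simp add: power_mult_distrib power_divide algebra_simps)
  qed
  then show ?thesis
    using assms by (simp add: stienstra_coeff_binomial)
qed

end

theory Submission
  imports
    Defs
    "HOL-Number_Theory.Residues"
    "HOL-Computational_Algebra.Formal_Laurent_Series"
begin

text \<open>
  Put \<open>z = (-1)^r \<lambda>\<close> and \<open>n\<^sub>s = (m p^s - 1) / 2\<close>, so that \<open>n\<^sub>s\<^sub>+\<^sub>1 = p n\<^sub>s + (p - 1) / 2\<close>. Both
  \<open>F(\<lambda>)\<close> and Stienstra's coefficients at \<open>n\<^sub>s\<close> are sums of \<open>(x\<^sub>s choose k)^r z^k\<close> over \<open>k \<le> n\<^sub>s\<close>, with
  \<open>x\<^sub>s = -1/2\<close> and \<open>x\<^sub>s = n\<^sub>s\<close> respectively. Splitting \<open>k\<close> as \<open>p k' + i\<close> shows that replacing \<open>s + 1\<close> by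
  \<open>s\<close> amounts, modulo \<open>p^(s+1)\<close>, to applying to \<open>k \<mapsto> z^k\<close> one and the same operator \<open>U\<close>, which
  involves neither \<open>m\<close> nor \<open>s\<close>, because \<open>n\<^sub>s \<equiv> -1/2\<close> modulo \<open>p^s\<close>. On a space of twisted Lipschitz functions \<open>U\<close>
  has rank one modulo \<open>p\<close>, and its unit eigenvalue is the number \<open>\<alpha>\<close> of the congruence, for both
  families. The congruences say that for both logarithms \<open>l(\<tau>) - (\<alpha>/p) l(\<tau>^p)\<close> is integral, and
  Hazewinkel's functional equation lemma, with the same \<open>\<alpha>\<close>, yields the formal groups and the
  isomorphism.
\<close>

section \<open>Arithmetic of the \<open>p\<close>-adic integers\<close>

text \<open>For m > 1 the value of F at \<open>n\<^sub>s\<close> may be a non-unit or even 0, so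
  everything is proved in the form f(n_(s+1)) - \<alpha> f(n_s) \<equiv> 0 modulo p^(s+1), with no
  quotient. The loss d_m appears only in the final division, while the functional equation needs
  exactly the undivided form. The obstacle is that \<open>x choose k\<close> is continuous in x but
  not in k. Its quotient by the binomial coefficient at k div p is, and this makes U contract. The
  powers of p then come from iteration: U sends z^k to \<alpha> z^k + p v_0 and v_j to p v_(j+1), so
  that descending from level s to level 0 collects s factors p in the sum attached to v_0. The
  assumption on F at (p - 1)/2 says that the value at 0 of U applied to z^k is a unit. The
  isomorphism is the series l'^(-1)(l(\<tau>)); it is integral because l' applied to it gives l,
  which obeys the functional equation with the very \<alpha> that belongs to l'.\<close>

lemma Rep_padic_int_bounds:
  "0 \<le> Rep_padic_int (x :: 'p::prime_card padic_int) n"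
  "Rep_padic_int x n < int CARD('p) ^ n"
  using Rep_padic_int[of x] by auto

lemma Rep_padic_int_mod:
  "Rep_padic_int (x :: 'p::prime_card padic_int) n mod int CARD('p) ^ n = Rep_padic_int x n"
  by (simp add: Rep_padic_int_bounds)

lemma padic_int_eqI:
  assumes "\<And>n. Rep_padic_int x n = Rep_padic_int y n"
  shows "x = y"
  using assms by (metis Rep_padic_int_inject ext)

lemma Abs_padic_int_inverse':
  fixes f :: "nat \<Rightarrow> int"
  assumes "\<And>n. 0 \<le> f n" "\<And>n. f n < int CARD('p) ^ n"
    and "\<And>n. f (Suc n) mod int CARD('p) ^ n = f n"
  shows "Rep_padic_int (Abs_padic_int f :: 'p::prime_card padic_int) = f"
  by (rule Abs_padic_int_inverse) (use assms in auto)

lemma Rep_padic_int_power_CARD: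
  "Rep_padic_int (of_nat CARD('p) ^ n :: 'p::prime_card padic_int) m =
     int CARD('p) ^ n mod int CARD('p) ^ m"
  using Rep_padic_int_of_nat[of "CARD('p) ^ n" m, where 'p = 'p] by simp

lemma power_CARD_dvd_iff:
  fixes x :: "'p::prime_card padic_int"
  shows "of_nat CARD('p) ^ n dvd x \<longleftrightarrow> Rep_padic_int x n = 0"
proof
  assume "of_nat CARD('p) ^ n dvd x"
  then show "Rep_padic_int x n = 0"
    by (auto elim!: dvdE simp: times_padic_int.rep_eq Rep_padic_int_power_CARD)
next
  let ?q = "int CARD('p)"
  assume x: "Rep_padic_int x n = 0"
  \<comment> \<open>Division by p^n turns a residue modulo p^(m+n) into one modulo p^m, hence the
    shifted index.\<close>
  define y where "y m = Rep_padic_int x (m + n) div ?q ^ n" for m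
  have x_eq: "Rep_padic_int x (m + n) = ?q ^ n * y m" for m
    using Rep_padic_int_mod_le[of n "m + n" x] x unfolding y_def by auto
  have "Rep_padic_int (Abs_padic_int y :: 'p padic_int) = y"
  proof (rule Abs_padic_int_inverse')
    fix m
    show "0 \<le> y m"
      unfolding y_def by (simp add: Rep_padic_int_bounds pos_imp_zdiv_nonneg_iff)
    have "?q ^ n * y m < ?q ^ n * ?q ^ m"
      using Rep_padic_int_bounds(2)[of x "m + n"] x_eq[of m] by (simp add: power_add mult.commute)
    then show "y m < ?q ^ m"
      by simp
    have "?q ^ n * (y (Suc m) mod ?q ^ m) = (?q ^ n * y (Suc m)) mod (?q ^ n * ?q ^ m)"
      by (rule mod_mult_mult1[symmetric])
    also have "\<dots> = Rep_padic_int x (Suc m + n) mod ?q ^ (m + n)"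
      by (simp only: x_eq power_add mult.commute[of "?q ^ n" "?q ^ m"])
    also have "\<dots> = ?q ^ n * y m"
      by (subst Rep_padic_int_mod_le) (simp_all add: x_eq)
    finally show "y (Suc m) mod ?q ^ m = y m"
      by simp
  qed
  then have "Rep_padic_int (of_nat CARD('p) ^ n * Abs_padic_int y :: 'p padic_int) m = Rep_padic_int x m" for m
    using Rep_padic_int_mod_le[of m "m + n" x]
    by (simp add: times_padic_int.rep_eq Rep_padic_int_power_CARD mod_mult_left_eq x_eq)
  then have "x = of_nat CARD('p) ^ n * Abs_padic_int y"
    by (metis padic_int_eqI)
  then show "of_nat CARD('p) ^ n dvd x"
    by (metis dvd_triv_left)
qed

lemma Rep_padic_int_diff:
  "Rep_padic_int (x - y :: 'p::prime_card padic_int) n =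
     (Rep_padic_int x n - Rep_padic_int y n) mod int CARD('p) ^ n"
  unfolding minus_padic_int_def plus_padic_int.rep_eq uminus_padic_int.rep_eq mod_add_right_eq
  by simp

lemma power_CARD_dvd_diff_iff:
  fixes x y :: "'p::prime_card padic_int"
  shows "of_nat CARD('p) ^ n dvd x - y \<longleftrightarrow> Rep_padic_int x n = Rep_padic_int y n"
  unfolding power_CARD_dvd_iff Rep_padic_int_diff
  by (metis Rep_padic_int_mod mod_eq_0_iff_dvd mod_eq_dvd_iff)

lemma padic_int_approx_nat:
  fixes x :: "'p::prime_card padic_int"
  obtains k where "of_nat CARD('p) ^ n dvd x - of_nat k"
proof
  show "of_nat CARD('p) ^ n dvd x - of_nat (nat (Rep_padic_int x n))"
    using Rep_padic_int_bounds[of x n]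
    by (simp add: power_CARD_dvd_diff_iff Rep_padic_int_of_nat del: of_nat_nat)
qed

text \<open>The n-th residue of \<open>f\<close> is frozen from index n on, so the diagonal residues
  are compatible and define the limit.\<close>

lemma padic_int_Cauchy_limit:
  fixes f :: "nat \<Rightarrow> 'p::prime_card padic_int"
  assumes "\<And>n. of_nat CARD('p) ^ n dvd f (Suc n) - f n"
  obtains x where "\<And>n. of_nat CARD('p) ^ n dvd x - f n"
proof
  have "Rep_padic_int (f (Suc n)) n = Rep_padic_int (f n) n" for n
    using assms[of n] by (simp add: power_CARD_dvd_diff_iff)
  then have "Rep_padic_int (Abs_padic_int (\<lambda>n. Rep_padic_int (f n) n) :: 'p padic_int)
      = (\<lambda>n. Rep_padic_int (f n) n)"
    by (intro Abs_padic_int_inverse') (simp_all add: Rep_padic_int_bounds Rep_padic_int_mod_le)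
  then show "of_nat CARD('p) ^ n dvd Abs_padic_int (\<lambda>n. Rep_padic_int (f n) n) - f n" for n
    by (simp add: power_CARD_dvd_diff_iff)
qed

section \<open>Units, valuations and Fermat congruences\<close>

lemma CARD_dvd_of_nat_iff:
  "(of_nat CARD('p) :: 'p::prime_card padic_int) dvd of_nat k \<longleftrightarrow> CARD('p) dvd k"
  using power_CARD_dvd_iff[of 1 "of_nat k :: 'p padic_int"]
  by (simp add: Rep_padic_int_of_nat flip: of_nat_mod dvd_eq_mod_eq_0)

text \<open>Inverses exist modulo every p^n and are unique there; uniqueness makes them compatible
  under reduction.\<close>

lemma padic_int_unit:
  fixes x :: "'p::prime_card padic_int"
  assumes "\<not> of_nat CARD('p) dvd x"
  shows "x dvd 1"
proof -
  let ?q = "int CARD('p)"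
  have prime: "prime ?q"
    using prime_card[where 'a = 'p] by simp
  have "coprime (Rep_padic_int x n) (?q ^ n)" for n
  proof (cases "n = 0")
    case False
    have "Rep_padic_int x 1 \<noteq> 0"
      using assms power_CARD_dvd_iff[of 1 x] by simp
    then have "\<not> ?q dvd Rep_padic_int x n"
      using Rep_padic_int_mod_le[of 1 n x] False by auto
    then show ?thesis
      using prime prime_imp_coprime coprime_commute by (metis coprime_power_right_iff)
  qed simp
  then have "\<exists>y. [Rep_padic_int x n * y = 1] (mod ?q ^ n)" for n
    by (rule cong_solve_coprime_int)
  then obtain b where b: "\<And>n. [Rep_padic_int x n * b n = 1] (mod ?q ^ n)"
    by metis
  define y where "y n = b n mod ?q ^ n" for n
  have y: "[Rep_padic_int x n * y n = 1] (mod ?q ^ n)" for n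
    using b[of n] by (simp add: y_def cong_def mod_mult_right_eq)
  have Rep: "Rep_padic_int (Abs_padic_int y :: 'p padic_int) = y"
  proof (rule Abs_padic_int_inverse')
    fix n
    show "0 \<le> y n" "y n < ?q ^ n"
      unfolding y_def by simp_all
    have "[Rep_padic_int x (Suc n) * y (Suc n) = 1] (mod ?q ^ n)"
      using y[of "Suc n"] by (rule cong_dvd_modulus) simp
    moreover have "[Rep_padic_int x (Suc n) = Rep_padic_int x n] (mod ?q ^ n)"
      by (simp add: cong_def Rep_padic_int_mod_le Rep_padic_int_mod)
    ultimately have "[Rep_padic_int x n * y (Suc n) = 1] (mod ?q ^ n)"
      by (metis cong_scalar_right cong_sym cong_trans)
    then have "[Rep_padic_int x n * y (Suc n) = Rep_padic_int x n * y n] (mod ?q ^ n)"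
      using y cong_sym cong_trans by metis
    then have "[y (Suc n) = y n] (mod ?q ^ n)"
      using \<open>coprime (Rep_padic_int x n) (?q ^ n)\<close> by (simp add: cong_mult_lcancel)
    then show "y (Suc n) mod ?q ^ n = y n"
      by (simp add: cong_def y_def)
  qed
  have "x * Abs_padic_int y = 1"
    by (rule padic_int_eqI)
      (use y in \<open>simp add: times_padic_int.rep_eq one_padic_int.rep_eq Rep cong_def\<close>)
  then show ?thesis
    by (metis dvd_triv_left)
qed

lemma CARD_not_unit: "\<not> (of_nat CARD('p) :: 'p::prime_card padic_int) dvd 1"
  using CARD_dvd_of_nat_iff[of 1, where 'p = 'p] prime_gt_1_nat[OF prime_card[where 'a = 'p]] by simp

lemma CARD_nonzero: "(of_nat CARD('p) :: 'p::prime_card padic_int) \<noteq> 0"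
  using CARD_prime_card_pos[where 'p = 'p] by simp

lemma padic_int_eq_power_times_unit:
  fixes x :: "'p::prime_card padic_int"
  assumes "x \<noteq> 0"
  obtains d u where "x = of_nat CARD('p) ^ d * u" "u dvd 1"
proof -
  obtain n where n: "Rep_padic_int x n \<noteq> 0"
    using assms padic_int_eqI[of x 0] by (auto simp: zero_padic_int.rep_eq)
  \<comment> \<open>Entry 0 is a residue modulo 1 and always vanishes, so the search runs over
    successors and \<open>d\<close> is the valuation itself.\<close>
  define d where "d = (LEAST n. Rep_padic_int x (Suc n) \<noteq> 0)"
  have "Rep_padic_int x 0 = 0"
    using Rep_padic_int_bounds[of x 0] by simp
  with n have "\<exists>n. Rep_padic_int x (Suc n) \<noteq> 0"
    by (metis not0_implies_Suc)
  then have d: "Rep_padic_int x (Suc d) \<noteq> 0"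
    unfolding d_def by (rule LeastI_ex)
  have "Rep_padic_int x d = 0"
  proof (cases d)
    case (Suc e)
    then have "e < d" by simp
    then show ?thesis
      using not_less_Least[of e "\<lambda>n. Rep_padic_int x (Suc n) \<noteq> 0"] Suc by (simp flip: d_def)
  qed (use \<open>Rep_padic_int x 0 = 0\<close> in simp)
  then obtain u where u: "x = of_nat CARD('p) ^ d * u"
    by (auto simp flip: power_CARD_dvd_iff)
  have "\<not> of_nat CARD('p) dvd u"
  proof
    assume "of_nat CARD('p) dvd u"
    then have "of_nat CARD('p) ^ Suc d dvd x"
      unfolding u by (simp add: mult.commute mult_dvd_mono)
    with d show False
      by (simp only: power_CARD_dvd_iff)
  qed
  with u show ?thesis
    using that padic_int_unit by blast
qed

lemma padic_int_fermat:
  "(of_nat CARD('p) :: 'p::prime_card padic_int) dvd x ^ CARD('p) - x"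
proof -
  let ?q = "of_nat CARD('p) :: 'p padic_int"
  obtain k where "?q ^ 1 dvd x - of_nat k"
    by (rule padic_int_approx_nat)
  then have k: "?q dvd x - of_nat k" by simp
  have "[k ^ CARD('p) = k] (mod CARD('p))"
  proof (cases "CARD('p) dvd k")
    case True
    moreover have "CARD('p) dvd k ^ CARD('p)"
      using True CARD_prime_card_pos[where 'p = 'p] dvd_trans by (metis dvd_power)
    ultimately show ?thesis
      by (metis cong_0_iff cong_sym cong_trans)
  next
    case False
    then have "[k ^ (CARD('p) - 1) * k = 1 * k] (mod CARD('p))"
      using fermat_theorem[OF prime_card] by (intro cong_mult) auto
    then show ?thesis
      using CARD_prime_card_pos[where 'p = 'p] by (simp flip: power_Suc2)
  qed
  then have "int CARD('p) dvd int (k ^ CARD('p)) - int k"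
    by (simp add: cong_iff_dvd_diff flip: cong_int_iff)
  then obtain c where c: "int k ^ CARD('p) - int k = int CARD('p) * c"
    by auto
  have "?q dvd of_int (int k ^ CARD('p) - int k)"
    unfolding c by simp
  then have "?q dvd of_nat k ^ CARD('p) - of_nat k"
    by simp
  moreover have "?q dvd x ^ CARD('p) - of_nat k ^ CARD('p)"
    using k by (metis dvd_mult2 power_diff_sumr2)
  ultimately have "?q dvd (x ^ CARD('p) - of_nat k ^ CARD('p)) + (of_nat k ^ CARD('p) - of_nat k) - (x - of_nat k)"
    using k by (metis dvd_add dvd_diff)
  then show ?thesis
    by (simp add: algebra_simps)
qed

text \<open>In a^q - b^q = (a - b) * sum, the sum has q terms, each congruent to b^(q-1) modulo q,
  and so supplies one more factor q.\<close>

lemma power_dvd_diff_power: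
  fixes a b :: "'a::comm_ring_1"
  assumes "of_nat q ^ Suc j dvd a - b"
  shows "of_nat q ^ Suc (Suc j) dvd a ^ q - b ^ q"
proof -
  have ab: "of_nat q dvd a - b"
    using assms by (metis dvd_mult_left power_Suc)
  have "of_nat q dvd (\<Sum>i<q. b ^ (q - Suc i) * a ^ i - b ^ (q - Suc i) * b ^ i)"
    by (intro dvd_sum) (metis ab dvd_mult dvd_mult2 power_diff_sumr2 right_diff_distrib)
  moreover have "(\<Sum>i<q. b ^ (q - Suc i) * b ^ i) = of_nat q * b ^ (q - 1)"
    by (simp flip: power_add)
  ultimately have "of_nat q dvd (\<Sum>i<q. b ^ (q - Suc i) * a ^ i)"
    unfolding sum_subtractf by (metis dvd_triv_left dvd_diff_right_iff diff_add_cancel dvd_add)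
  with assms have "of_nat q ^ Suc j * of_nat q dvd (a - b) * (\<Sum>i<q. b ^ (q - Suc i) * a ^ i)"
    by (rule mult_dvd_mono)
  then show ?thesis
    by (simp add: power_diff_sumr2[of a q b] mult.commute)
qed

lemma power_dvd_diff_power_power:
  fixes a b :: "'a::comm_ring_1"
  assumes "of_nat q dvd a - b"
  shows "of_nat q ^ Suc j dvd a ^ q ^ j - b ^ q ^ j"
proof (induction j)
  case (Suc j)
  then show ?case
    using power_dvd_diff_power[OF Suc] by (simp add: mult.commute flip: power_mult)
qed (use assms in simp)

text \<open>This lets z^(p^(j+1)) be traded for z^(p^j) when \<open>dwork_op\<close> rescales a step
  p^(j+1) to p^j, also for z divisible by p.\<close>

lemma padic_int_fermat_power:
  "(of_nat CARD('p) :: 'p::prime_card padic_int) ^ Suc j dvd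
     x ^ CARD('p) ^ Suc j - x ^ CARD('p) ^ j"
  using power_dvd_diff_power_power[OF padic_int_fermat[of x], of j] by (simp flip: power_mult)

abbreviation padic_p :: "'p::prime_card padic_int" where
  "padic_p \<equiv> of_nat CARD('p)"

section \<open>Congruences in a commutative ring\<close>

lemma dvd_diff_refl: "(d :: 'a::comm_ring_1) dvd a - a"
  by simp

lemma dvd_diff_sym: "(d :: 'a::comm_ring_1) dvd a - b \<Longrightarrow> d dvd b - a"
  by (metis dvd_minus_iff minus_diff_eq)

lemma dvd_diff_trans: "(d :: 'a::comm_ring_1) dvd a - b \<Longrightarrow> d dvd b - c \<Longrightarrow> d dvd a - c"
  by (metis diff_add_cancel add_diff_eq dvd_add)

lemma dvd_diff_mult:
  assumes "(d :: 'a::comm_ring_1) dvd a - a'" "d dvd b - b'"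
  shows "d dvd a * b - a' * b'"
proof -
  have "a * b - a' * b' = (a - a') * b + a' * (b - b')"
    by (simp add: algebra_simps)
  with assms show ?thesis
    by (metis dvd_add dvd_mult dvd_mult2)
qed

lemma dvd_diff_power: "(d :: 'a::comm_ring_1) dvd a - b \<Longrightarrow> d dvd a ^ n - b ^ n"
  by (metis dvd_mult2 power_diff_sumr2)

lemma dvd_diff_prod:
  assumes "\<And>i. i \<in> I \<Longrightarrow> (d :: 'a::comm_ring_1) dvd f i - g i"
  shows "d dvd prod f I - prod g I"
  using assms by (induction I rule: infinite_finite_induct) (auto intro: dvd_diff_mult)

lemma dvd_diff_sum:
  assumes "\<And>i. i \<in> I \<Longrightarrow> (d :: 'a::comm_ring_1) dvd f i - g i"
  shows "d dvd sum f I - sum g I"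
  unfolding sum_subtractf[symmetric] using assms by (rule dvd_sum)

lemma unit_dvd_cancel:
  assumes "(u :: 'a::comm_ring_1) dvd 1" "d dvd u * y"
  shows "d dvd y"
proof -
  from assms(1) obtain v where "1 = u * v" ..
  then have "y = (u * y) * v"
    by (metis mult.commute mult.left_commute mult_1)
  then show ?thesis
    using assms(2) by (metis dvd_mult2)
qed

lemma padic_p_dvd_of_nat_diff_iff:
  "(padic_p :: 'p::prime_card padic_int) dvd of_nat a - of_nat b \<longleftrightarrow> a mod CARD('p) = b mod CARD('p)"
  using power_CARD_dvd_diff_iff[of 1 "of_nat a :: 'p padic_int" "of_nat b"]
  by (simp add: Rep_padic_int_of_nat flip: of_nat_mod)

section \<open>Binomial coefficients and their \<open>p\<close>-adic Lipschitz quotients\<close>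

definition unit_part :: "'p::prime_card padic_int \<Rightarrow> 'p padic_int" where
  "unit_part u = (if padic_p dvd u then 1 else u)"

lemma unit_part_unit: "unit_part u dvd 1"
  by (simp add: unit_part_def padic_int_unit)

lemma unit_part_cong:
  fixes u v :: "'p::prime_card padic_int"
  assumes "padic_p ^ Suc j dvd u - v"
  shows "padic_p ^ Suc j dvd unit_part u - unit_part v"
proof -
  have "padic_p dvd u - v"
    using assms by (metis dvd_mult_left power_Suc)
  then have "padic_p dvd u \<longleftrightarrow> padic_p dvd v"
    by (metis diff_add_cancel dvd_add dvd_diff diff_diff_eq2 add_diff_cancel_left')
  with assms show ?thesis
    by (simp add: unit_part_def)
qed

definition unit_prod :: "(nat \<Rightarrow> 'p::prime_card padic_int) \<Rightarrow> nat \<Rightarrow> 'p padic_int" where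
  "unit_prod f K = (\<Prod>i<K. unit_part (f i))"

lemma prod_unit: "(\<And>i. i \<in> I \<Longrightarrow> f i dvd (1 :: 'a::comm_semiring_1)) \<Longrightarrow> prod f I dvd 1"
proof (induction I rule: infinite_finite_induct)
  case (insert x F)
  then show ?case
    using mult_dvd_mono[of "f x" 1 "prod f F" 1] by simp
qed auto

lemma unit_prod_unit: "unit_prod f K dvd 1"
  unfolding unit_prod_def by (rule prod_unit) (rule unit_part_unit)

text \<open>The factors divisible by p sit at the indices congruent to h: one in each of the k full
  blocks, and one more in the last partial block exactly when it reaches beyond h.\<close>

lemma prod_eq_unit_prod:
  fixes f f' :: "nat \<Rightarrow> 'p::prime_card padic_int"
  assumes f: "\<And>i. padic_p dvd f i \<longleftrightarrow> i mod CARD('p) = h" "\<And>i. f (CARD('p) * i + h) = padic_p * f' i"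
    and h: "h < CARD('p)" and j: "j \<le> CARD('p)"
  shows "(\<Prod>i<CARD('p) * k + j. f i) =
    unit_prod f (CARD('p) * k + j) * padic_p ^ k *
    (\<Prod>i<k. f' i) * (if j > h then padic_p * f' k else 1)"
  using j
proof (induction k arbitrary: j)
  case outer: 0
  show ?case
    using outer
  proof (induction j)
    case (Suc j)
    then show ?case
      using f(1)[of j] f(2)[of 0] by (auto simp: unit_prod_def unit_part_def)
  qed (simp add: unit_prod_def)
next
  case outer: (Suc k)
  show ?case
    using outer(2)
  proof (induction j)
    case 0
    show ?case
      using outer.IH[of "CARD('p)"] h by (simp add: algebra_simps)
  next
    case (Suc j)
    then have "(CARD('p) * Suc k + j) mod CARD('p) = j"
      by (simp del: mult_Suc_right)
    then show ?case
      using Suc f(1)[of "CARD('p) * Suc k + j"] f(2)[of "Suc k"]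
      by (auto simp: unit_prod_def unit_part_def mult.assoc simp del: mult_Suc_right)
  qed
qed

text \<open>The generalized binomial coefficients \<open>x choose k\<close>, with denominators
  cleared because k! need not be invertible in Z_p. As k! is nonzero, x determines
  \<open>A\<close>.\<close>

definition binomial_seq :: "'p::prime_card padic_int \<Rightarrow> (nat \<Rightarrow> 'p padic_int) \<Rightarrow> bool" where
  "binomial_seq x A \<longleftrightarrow> (\<forall>k. fact k * A k = (\<Prod>i<k. x - of_nat i))"

definition uinv :: "'a::comm_ring_1 \<Rightarrow> 'a" where
  "uinv u = (SOME v. u * v = 1)"

lemma mult_uinv: "u dvd 1 \<Longrightarrow> u * uinv u = 1"
  unfolding uinv_def by (rule someI_ex) (metis dvdE)

text \<open>
  For \<open>x = p x' + h\<close> with \<open>0 \<le> h < p\<close> this is the quotient of \<open>x choose K\<close> by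
  \<open>x' choose (K div p)\<close>; unlike the binomial coefficients themselves it is Lipschitz in \<open>K\<close>.
\<close>

definition binomial_quot :: "nat \<Rightarrow> 'p::prime_card padic_int \<Rightarrow> nat \<Rightarrow> 'p padic_int" where
  "binomial_quot h x K =
     (if K mod CARD('p) > h then x - of_nat (h + CARD('p) * (K div CARD('p))) else 1) *
     unit_prod (\<lambda>i. x - of_nat i) K * uinv (unit_prod (\<lambda>i. of_nat (Suc i)) K)"

text \<open>Numerator and factorial are both split into units and multiples of p. Divided by p, the
  multiples form the corresponding products for x' and K div p. A possible surplus factor of the
  numerator, p (x' - K div p), stays in the quotient; the factorial has none, its multiples of p
  being the last factors of their blocks.\<close>

lemma binomial_seq_quot:
  fixes x x' :: "'p::prime_card padic_int"
  assumes x: "x = padic_p * x' + of_nat h" and h: "h < CARD('p)"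
    and A: "binomial_seq x A" and A': "binomial_seq x' A'"
  shows "A K = A' (K div CARD('p)) * binomial_quot h x K"
proof -
  define k j where "k = K div CARD('p)" and "j = K mod CARD('p)"
  have K: "K = CARD('p) * k + j"
    by (simp add: k_def j_def)
  have j: "j < CARD('p)"
    using CARD_prime_card_pos[where 'p = 'p] by (simp add: j_def)
  let ?P = "unit_prod (\<lambda>i. x - of_nat i) K" and ?Q = "unit_prod (\<lambda>i. of_nat (Suc i)) K :: 'p padic_int"
  let ?t = "if j > h then x - of_nat (h + CARD('p) * k) else 1"
  have "padic_p dvd x - of_nat i \<longleftrightarrow> i mod CARD('p) = h" for i
  proof -
    have "x - of_nat i = padic_p * x' + (of_nat h - of_nat i)"
      by (simp add: x)
    then have "padic_p dvd x - of_nat i \<longleftrightarrow> (padic_p :: 'p padic_int) dvd of_nat h - of_nat i"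
      by (metis dvd_add_right_iff dvd_triv_left)
    then show ?thesis
      using h by (auto simp: padic_p_dvd_of_nat_diff_iff)
  qed
  moreover have "x - of_nat (CARD('p) * i + h) = padic_p * (x' - of_nat i)" for i
    by (simp add: x algebra_simps)
  ultimately have "(\<Prod>i<K. x - of_nat i) = ?P * padic_p ^ k * (\<Prod>i<k. x' - of_nat i) *
      (if j > h then padic_p * (x' - of_nat k) else 1)"
    unfolding K using h j by (intro prod_eq_unit_prod) simp_all
  also have "(if j > h then padic_p * (x' - of_nat k) else 1) = ?t"
    by (simp add: x algebra_simps)
  also have "(\<Prod>i<k. x' - of_nat i) = fact k * A' k"
    using A' by (simp add: binomial_seq_def)
  finally have 1: "fact K * A K = ?P * padic_p ^ k * (fact k * A' k) * ?t"
    using A by (simp add: binomial_seq_def)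
  have fact_eq: "fact n = (\<Prod>i<n. of_nat (Suc i) :: 'p padic_int)" for n
    by (induction n) (simp_all add: mult.commute)
  have "(padic_p :: 'p padic_int) dvd of_nat (Suc i) \<longleftrightarrow> i mod CARD('p) = CARD('p) - 1" for i
    unfolding CARD_dvd_of_nat_iff dvd_eq_mod_eq_0
    using prime_gt_1_nat[OF prime_card[where 'a = 'p]] by (auto simp: mod_Suc)
  then have "(\<Prod>i<K. of_nat (Suc i)) = ?Q * padic_p ^ k * (\<Prod>i<k. of_nat (Suc i)) *
      (if j > CARD('p) - 1 then padic_p * of_nat (Suc k) else 1)"
    unfolding K using j
    by (intro prod_eq_unit_prod) (simp_all add: algebra_simps flip: of_nat_add of_nat_mult)
  then have 2: "fact K = ?Q * padic_p ^ k * fact k"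
    using j by (simp add: fact_eq)
  have "(padic_p ^ k * fact k) * (?Q * A K) = (padic_p ^ k * fact k) * (A' k * (?t * ?P))"
    using 1 unfolding 2 by (simp add: ac_simps)
  then have "?Q * A K = A' k * (?t * ?P)"
    using CARD_nonzero[where 'p = 'p] by (simp only: mult_cancel_left) simp
  then have "(?Q * uinv ?Q) * A K = A' k * (?t * ?P * uinv ?Q)"
    by (simp add: ac_simps)
  moreover have "?Q * uinv ?Q = 1"
    by (rule mult_uinv) (rule unit_prod_unit)
  ultimately show ?thesis
    by (simp only: binomial_quot_def mult_1 flip: k_def j_def)
qed

text \<open>Moving the window by one exchanges the factor at K for the one at K + M. These are
  congruent, and the unit at K can be cancelled.\<close>

lemma periodic_prod_shift:
  fixes c :: "nat \<Rightarrow> 'a::comm_ring_1"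
  assumes periodic: "\<And>i. d dvd c (i + M) - c i" and unit: "\<And>i. c i dvd 1"
  shows "d dvd (\<Prod>i<M. c (K + i)) - (\<Prod>i<M. c i)"
proof (induction K)
  case (Suc K)
  let ?W = "\<lambda>K. \<Prod>i<M. c (K + i)"
  have "(\<Prod>i<Suc M. c (K + i)) = c K * ?W (Suc K)"
    by (subst prod.lessThan_Suc_shift) simp
  then have "c K * (?W (Suc K) - ?W K) = ?W K * (c (K + M) - c K)"
    by (simp add: algebra_simps)
  then have "d dvd ?W (Suc K) - ?W K"
    using periodic unit by (metis dvd_mult unit_dvd_cancel)
  then show ?case
    using Suc by (rule dvd_diff_trans)
qed simp

lemma unit_prod_add:
  fixes f :: "nat \<Rightarrow> 'p::prime_card padic_int"
  assumes "\<And>i. padic_p ^ Suc j dvd f (i + M) - f i"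
  shows "padic_p ^ Suc j dvd unit_prod f (K + M) - unit_prod f K * unit_prod f M"
proof -
  have "unit_prod f (K + M) = unit_prod f K * (\<Prod>i<M. unit_part (f (K + i)))"
    unfolding unit_prod_def by (induction M) (simp_all add: mult.assoc)
  moreover have "padic_p ^ Suc j dvd (\<Prod>i<M. unit_part (f (K + i))) - unit_prod f M"
    unfolding unit_prod_def
    by (rule periodic_prod_shift) (simp_all add: assms unit_part_cong unit_part_unit del: power_Suc)
  ultimately show ?thesis
    by (simp add: dvd_diff_mult)
qed

text \<open>
  Both products run over all residues prime to \<open>p\<close>, so the constant of Wilson's theorem cancels
  in the quotient.
\<close>

lemma unit_prod_period:
  fixes x :: "'p::prime_card padic_int"
  defines "M j \<equiv> CARD('p) ^ Suc j"
  shows "padic_p ^ Suc j dvd unit_prod (\<lambda>i. x - of_nat i) (M j) -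
    unit_prod (\<lambda>i. of_nat (Suc i)) (M j)"
proof -
  let ?M = "M j" and ?c = "\<lambda>i. unit_part (of_nat (Suc i)) :: 'p padic_int"
  have M: "(of_nat ?M :: 'p padic_int) = padic_p ^ Suc j"
    by (simp add: M_def)
  obtain n0 where n0: "padic_p ^ Suc j dvd x - of_nat n0"
    by (rule padic_int_approx_nat)
  \<comment> \<open>Adding a full period keeps the residue and makes n - i positive for all i < M,
    so the factors are natural numbers met in descending order.\<close>
  define n where "n = n0 + ?M"
  have n: "padic_p ^ Suc j dvd x - of_nat n"
  proof -
    have "x - of_nat n = (x - of_nat n0) - padic_p ^ Suc j"
      by (simp add: n_def M del: power_Suc)
    then show ?thesis
      using n0 by (metis dvd_diff dvd_refl)
  qed
  have "padic_p ^ Suc j dvd unit_prod (\<lambda>i. x - of_nat i) ?M - (\<Prod>i<?M. unit_part (of_nat n - of_nat i))"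
    unfolding unit_prod_def by (intro dvd_diff_prod unit_part_cong) (use n in simp)
  also have "(\<Prod>i<?M. unit_part (of_nat n - of_nat i)) = (\<Prod>i<?M. ?c (n0 + (?M - Suc i)))"
    by (rule prod.cong) (auto simp: n_def Suc_diff_Suc of_nat_diff)
  also have "\<dots> = (\<Prod>i<?M. ?c (n0 + i))"
    by (rule prod.nat_diff_reindex)
  finally have 1: "padic_p ^ Suc j dvd unit_prod (\<lambda>i. x - of_nat i) ?M - (\<Prod>i<?M. ?c (n0 + i))" .
  have "padic_p ^ Suc j dvd (\<Prod>i<?M. ?c (n0 + i)) - (\<Prod>i<?M. ?c i)"
    by (rule periodic_prod_shift) (auto intro!: unit_part_cong simp: unit_part_unit M simp del: power_Suc)
  with 1 show ?thesis
    unfolding unit_prod_def by (rule dvd_diff_trans)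
qed

text \<open>Over a period, numerator and denominator acquire the factors \<open>P ?M\<close> and
  \<open>Q ?M\<close>, which agree modulo p^(j+1) and are units, so the ratio is unchanged. The
  surplus linear factor moves by p * p^j.\<close>

lemma binomial_quot_period:
  fixes x :: "'p::prime_card padic_int"
  shows "padic_p ^ Suc j dvd binomial_quot h x (K + CARD('p) ^ Suc j) - binomial_quot h x K"
proof -
  let ?M = "CARD('p) ^ Suc j"
  let ?d = "padic_p ^ Suc j :: 'p padic_int"
  define P Q where "P = unit_prod (\<lambda>i. x - of_nat i)"
    and "Q = (unit_prod (\<lambda>i. of_nat (Suc i)) :: nat \<Rightarrow> 'p padic_int)"
  define t where "t K = (if K mod CARD('p) > h then x - of_nat (h + CARD('p) * (K div CARD('p))) else 1)" for K
  define R where "R K = P K * uinv (Q K)" for K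
  have QQ: "Q K * uinv (Q K) = 1" for K
    unfolding Q_def by (rule mult_uinv) (rule unit_prod_unit)
  then have RQ: "R K * Q K = P K" for K
    by (simp add: R_def mult.assoc mult.commute[of "uinv _"])
  have P: "?d dvd P (K + ?M) - P K * P ?M"
    unfolding P_def by (rule unit_prod_add) simp
  have Q: "?d dvd Q (K + ?M) - Q K * Q ?M"
    unfolding Q_def by (rule unit_prod_add) simp
  have PQ: "?d dvd P ?M - Q ?M"
    unfolding P_def Q_def by (rule unit_prod_period)
  have "?d dvd R (K + ?M) * (Q K * Q ?M) - R (K + ?M) * Q (K + ?M)"
    using dvd_diff_mult[OF dvd_diff_refl dvd_diff_sym[OF Q]] .
  also have "R (K + ?M) * Q (K + ?M) = P (K + ?M)"
    by (rule RQ)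
  finally have "?d dvd R (K + ?M) * (Q K * Q ?M) - P K * P ?M"
    using P dvd_diff_trans by blast
  then have "?d dvd R (K + ?M) * (Q K * Q ?M) - P K * Q ?M"
    using dvd_diff_mult[OF dvd_diff_refl PQ] dvd_diff_trans by blast
  then have "?d dvd (Q K * Q ?M) * (R (K + ?M) - R K)"
    unfolding RQ[symmetric] by (simp add: algebra_simps)
  moreover have "Q K * Q ?M dvd 1"
    unfolding Q_def using mult_dvd_mono[OF unit_prod_unit unit_prod_unit] by (metis mult_1)
  ultimately have R: "?d dvd R (K + ?M) - R K"
    using unit_dvd_cancel by blast
  have "?d dvd t (K + ?M) - t K"
  proof -
    have "(K + ?M) div CARD('p) = K div CARD('p) + CARD('p) ^ j"
      using CARD_prime_card_pos[where 'p = 'p] by simp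
    then show ?thesis
      by (simp add: t_def algebra_simps)
  qed
  from dvd_diff_mult[OF this R] show ?thesis
    by (simp add: binomial_quot_def t_def R_def P_def Q_def mult.assoc)
qed

lemma binomial_quot_cong:
  fixes x y :: "'p::prime_card padic_int"
  assumes "padic_p ^ Suc j dvd x - y"
  shows "padic_p ^ Suc j dvd binomial_quot h x K - binomial_quot h y K"
  unfolding binomial_quot_def unit_prod_def
  by (intro dvd_diff_mult dvd_diff_refl dvd_diff_prod unit_part_cong) (use assms in auto)

section \<open>The unit root of the Dwork operator\<close>

text \<open>
  The relation is with \<open>z^(p^j)\<close>, not with \<open>1\<close>, so that \<open>k \<mapsto> z^k\<close> belongs to the module for
  non-units \<open>z\<close> as well.
\<close>

definition twisted_lipschitz :: "'p::prime_card padic_int \<Rightarrow> (nat \<Rightarrow> 'p padic_int) set" where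
  "twisted_lipschitz z =
     {f. \<forall>j k. padic_p ^ j dvd f (k + CARD('p) ^ j) - z ^ (CARD('p) ^ j) * f k}"

lemma twisted_lipschitz_add:
  assumes "f \<in> twisted_lipschitz z" "g \<in> twisted_lipschitz z"
  shows "(\<lambda>k. a * f k + b * g k) \<in> twisted_lipschitz z"
proof -
  have "padic_p ^ j dvd (a * f (k + CARD('a) ^ j) + b * g (k + CARD('a) ^ j)) -
      z ^ (CARD('a) ^ j) * (a * f k + b * g k)" for j k
  proof -
    have "(a * f (k + CARD('a) ^ j) + b * g (k + CARD('a) ^ j)) -
        z ^ (CARD('a) ^ j) * (a * f k + b * g k) =
      a * (f (k + CARD('a) ^ j) - z ^ (CARD('a) ^ j) * f k) +
      b * (g (k + CARD('a) ^ j) - z ^ (CARD('a) ^ j) * g k)"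
      by (simp add: algebra_simps)
    then show ?thesis
      using assms unfolding twisted_lipschitz_def by (simp add: dvd_add dvd_mult)
  qed
  then show ?thesis
    by (simp add: twisted_lipschitz_def)
qed

lemma power_twisted_lipschitz: "(\<lambda>k. z ^ k) \<in> twisted_lipschitz z"
  by (simp add: twisted_lipschitz_def power_add mult.commute)

definition dwork_op :: "(nat \<Rightarrow> 'p::prime_card padic_int) \<Rightarrow> (nat \<Rightarrow> 'p padic_int) \<Rightarrow> nat \<Rightarrow> 'p padic_int" where
  "dwork_op g f k = (\<Sum>i<CARD('p). g (CARD('p) * k + i) * f (CARD('p) * k + i))"

lemma dwork_op_add:
  "dwork_op g (\<lambda>k. a * f k + b * f' k) k = a * dwork_op g f k + b * dwork_op g f' k"
  by (simp add: dwork_op_def sum_distrib_left sum.distrib algebra_simps)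

text \<open>A step p^j in k is a step p^(j+1) in p k + i, so the image satisfies the twisted
  relation with one extra power of p. For j = 0 this forces it to be a multiple of z^k modulo p, and
  after division by p the remainder still satisfies the original relation.\<close>

lemma dwork_op_decomp:
  fixes g f :: "nat \<Rightarrow> 'p::prime_card padic_int"
  assumes g: "\<And>j k. padic_p ^ Suc j dvd g (k + CARD('p) ^ Suc j) - g k"
    and f: "f \<in> twisted_lipschitz z"
  obtains f' where "f' \<in> twisted_lipschitz z"
    "\<And>k. dwork_op g f k = dwork_op g f 0 * z ^ k + padic_p * f' k"
proof -
  let ?U = "dwork_op g f"
  have U: "padic_p ^ Suc j dvd ?U (k + CARD('p) ^ j) - z ^ (CARD('p) ^ j) * ?U k" for j k
  proof -
    let ?M = "CARD('p) ^ Suc j"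
    have "padic_p ^ Suc j dvd g (CARD('p) * (k + CARD('p) ^ j) + i) * f (CARD('p) * (k + CARD('p) ^ j) + i)
        - g (CARD('p) * k + i) * (z ^ (CARD('p) ^ j) * f (CARD('p) * k + i))" for i
    proof (rule dvd_diff_mult)
      have eq: "CARD('p) * (k + CARD('p) ^ j) + i = (CARD('p) * k + i) + ?M"
        by (simp add: algebra_simps)
      show "padic_p ^ Suc j dvd g (CARD('p) * (k + CARD('p) ^ j) + i) - g (CARD('p) * k + i)"
        unfolding eq by (rule g)
      have "padic_p ^ Suc j dvd f (CARD('p) * (k + CARD('p) ^ j) + i) - z ^ ?M * f (CARD('p) * k + i)"
        unfolding eq using f by (simp only: twisted_lipschitz_def mem_Collect_eq)
      then show "padic_p ^ Suc j dvd f (CARD('p) * (k + CARD('p) ^ j) + i) - z ^ (CARD('p) ^ j) * f (CARD('p) * k + i)"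
        by (rule dvd_diff_trans) (rule dvd_diff_mult[OF padic_int_fermat_power dvd_diff_refl])
    qed
    then show ?thesis
      unfolding dwork_op_def sum_distrib_left
      by (intro dvd_diff_sum) (simp only: ac_simps)
  qed
  have "padic_p dvd ?U k - ?U 0 * z ^ k" for k
  proof (induction k)
    case (Suc k)
    have "padic_p dvd ?U (Suc k) - z * ?U k"
      using U[of 0 k] by simp
    moreover have "padic_p dvd z * ?U k - z * (?U 0 * z ^ k)"
      using Suc dvd_diff_mult dvd_diff_refl by blast
    ultimately show ?case
      using dvd_diff_trans by (simp add: mult.left_commute) blast
  qed simp
  then have "\<exists>y. ?U k - ?U 0 * z ^ k = padic_p * y" for k
    by (metis dvdE)
  then obtain f' where f': "\<And>k. ?U k - ?U 0 * z ^ k = padic_p * f' k"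
    by metis
  have "padic_p ^ j dvd f' (k + CARD('p) ^ j) - z ^ (CARD('p) ^ j) * f' k" for j k
  proof -
    have "padic_p * (f' (k + CARD('p) ^ j) - z ^ (CARD('p) ^ j) * f' k)
        = (?U (k + CARD('p) ^ j) - ?U 0 * z ^ (k + CARD('p) ^ j))
          - z ^ (CARD('p) ^ j) * (?U k - ?U 0 * z ^ k)"
      unfolding f' by (simp add: algebra_simps)
    also have "\<dots> = ?U (k + CARD('p) ^ j) - z ^ (CARD('p) ^ j) * ?U k"
      by (simp add: algebra_simps power_add)
    finally have "padic_p * padic_p ^ j dvd padic_p * (f' (k + CARD('p) ^ j) - z ^ (CARD('p) ^ j) * f' k)"
      using U[of j k] by simp
    then show ?thesis
      using CARD_nonzero[where 'p = 'p] by (simp only: dvd_mult_cancel_left) simp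
  qed
  then have "f' \<in> twisted_lipschitz z"
    by (simp add: twisted_lipschitz_def)
  moreover have "?U k = ?U 0 * z ^ k + padic_p * f' k" for k
    using f'[of k] by (simp add: algebra_simps)
  ultimately show ?thesis
    using that by blast
qed

text \<open>
  Modulo \<open>p\<close> the operator has rank one with image spanned by \<open>k \<mapsto> z^k\<close>; hence it is divisible
  by \<open>p\<close> on the complement of the unit root eigenspace, in which all the \<open>v j\<close> lie.
\<close>

lemma dwork_unit_root:
  fixes g :: "nat \<Rightarrow> 'p::prime_card padic_int"
  assumes g: "\<And>j k. padic_p ^ Suc j dvd g (k + CARD('p) ^ Suc j) - g k"
    and unit: "\<not> padic_p dvd dwork_op g (\<lambda>k. z ^ k) 0"
  obtains \<alpha> v where "\<alpha> dvd 1" "\<And>j. v j \<in> twisted_lipschitz z"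
    "\<And>k. dwork_op g (\<lambda>k. z ^ k) k = \<alpha> * z ^ k + padic_p * v 0 k"
    "\<And>j k. dwork_op g (v j) k = padic_p * v (Suc j) k"
proof -
  let ?M = "twisted_lipschitz z" and ?U = "dwork_op g"
  define H where "H s = (?U ^^ s) (\<lambda>k. z ^ k)" for s
  have H_Suc: "H (Suc s) = ?U (H s)" and H_0: "H 0 = (\<lambda>k. z ^ k)" for s
    by (simp_all add: H_def)
  have H: "\<exists>w\<in>?M. \<not> padic_p dvd H s 0 \<and> (\<forall>k. H s k = H s 0 * z ^ k + padic_p * w k)" for s
  proof (induction s)
    case 0
    have "(\<lambda>k. 0) \<in> ?M"
      by (simp add: twisted_lipschitz_def)
    then show ?case
      using CARD_not_unit[where 'p = 'p] by (intro bexI[of _ "\<lambda>k. 0"]) (auto simp: H_0)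
  next
    case (Suc s)
    then obtain w where w: "w \<in> ?M" "\<not> padic_p dvd H s 0"
      "\<And>k. H s k = H s 0 * z ^ k + padic_p * w k"
      by blast
    have eq: "H s = (\<lambda>k. H s 0 * z ^ k + padic_p * w k)"
      using w(3) by blast
    then have "H s \<in> ?M"
      using twisted_lipschitz_add[OF power_twisted_lipschitz w(1)] by metis
    then obtain w' where w': "w' \<in> ?M" "\<And>k. H (Suc s) k = H (Suc s) 0 * z ^ k + padic_p * w' k"
      using dwork_op_decomp[OF g] unfolding H_Suc by blast
    have "H (Suc s) 0 = H s 0 * ?U (\<lambda>k. z ^ k) 0 + padic_p * ?U w 0"
      unfolding H_Suc by (subst eq, subst dwork_op_add) simp
    moreover have "\<not> padic_p dvd H s 0 * ?U (\<lambda>k. z ^ k) 0"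
      using w(2) unit padic_int_unit unit_dvd_cancel by blast
    ultimately have "\<not> padic_p dvd H (Suc s) 0"
      by (metis dvd_add_left_iff dvd_triv_left)
    with w' show ?case
      by blast
  qed
  have H_M: "H s \<in> ?M" for s
  proof -
    obtain w where w: "w \<in> ?M" "\<And>k. H s k = H s 0 * z ^ k + padic_p * w k"
      using H by blast
    then have "H s = (\<lambda>k. H s 0 * z ^ k + padic_p * w k)"
      by blast
    then show ?thesis
      using twisted_lipschitz_add[OF power_twisted_lipschitz w(1)] by metis
  qed
  \<comment> \<open>\<open>a\<close> is an eigenvalue on \<open>H s\<close> up to p^(s+1). The error
    is required to stay in the module so that \<open>dwork_op_decomp\<close> applies to it
    again.\<close>
  define approx where "approx s a \<longleftrightarrow>
    (\<exists>v\<in>?M. \<forall>k. H (Suc s) k = a * H s k + padic_p ^ Suc s * v k)" for s a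
  have "\<exists>a. \<forall>s. approx s (a s) \<and> padic_p ^ Suc s dvd a (Suc s) - a s"
  proof (rule dependent_nat_choice)
    obtain w where w: "w \<in> ?M" "\<And>k. H 1 k = H 1 0 * z ^ k + padic_p * w k"
      using H by blast
    have "H (Suc 0) k = H 1 0 * H 0 k + padic_p ^ Suc 0 * w k" for k
      using w(2)[of k] by (simp only: H_0 One_nat_def power_Suc power_0 mult_1_right)
    with w(1) show "\<exists>a. approx 0 a"
      unfolding approx_def by blast
  next
    fix a s
    assume "approx s a"
    then obtain v where v: "v \<in> ?M" "\<And>k. H (Suc s) k = a * H s k + padic_p ^ Suc s * v k"
      unfolding approx_def by blast
    obtain w where w: "w \<in> ?M" "\<And>k. ?U v k = ?U v 0 * z ^ k + padic_p * w k"
      using dwork_op_decomp[OF g v(1)] by blast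
    obtain w' where w': "w' \<in> ?M" "\<not> padic_p dvd H (Suc s) 0"
      "\<And>k. H (Suc s) k = H (Suc s) 0 * z ^ k + padic_p * w' k"
      using H by blast
    from padic_int_unit[OF w'(2)] obtain e where e: "1 = H (Suc s) 0 * e" ..
    \<comment> \<open>Since \<open>H (Suc s) 0\<close> is a unit, z^k can be expressed by
      \<open>H (Suc s)\<close> modulo p. Thus \<open>b\<close> is the coefficient of
      \<open>?U v\<close> along \<open>H (Suc s)\<close>, and it corrects \<open>a\<close> at the
      order p^(s+1).\<close>
    define b where "b = ?U v 0 * e"
    define u where "u k = 1 * w k + (- b) * w' k" for k
    have u: "u \<in> ?M"
      unfolding u_def using w(1) w'(1) by (rule twisted_lipschitz_add)
    have Uv: "?U v k = b * H (Suc s) k + padic_p * u k" for k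
    proof -
      have "b * H (Suc s) k = ?U v 0 * (H (Suc s) 0 * e) * z ^ k + padic_p * (b * w' k)"
        by (subst w'(3)) (simp add: b_def algebra_simps)
      also have "\<dots> = ?U v 0 * z ^ k + padic_p * (b * w' k)"
        by (simp flip: e)
      finally show ?thesis
        by (subst w(2)) (simp add: u_def algebra_simps)
    qed
    have eq: "H (Suc s) = (\<lambda>k. a * H s k + padic_p ^ Suc s * v k)"
      using v(2) by blast
    have "H (Suc (Suc s)) k = (a + padic_p ^ Suc s * b) * H (Suc s) k + padic_p ^ Suc (Suc s) * u k" for k
    proof -
      have "H (Suc (Suc s)) k = a * H (Suc s) k + padic_p ^ Suc s * ?U v k"
        by (subst H_Suc, subst eq, subst dwork_op_add) (simp add: H_Suc)
      then show ?thesis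
        unfolding Uv by (simp add: algebra_simps)
    qed
    then show "\<exists>a'. approx (Suc s) a' \<and> padic_p ^ Suc s dvd a' - a"
      unfolding approx_def using u by (intro exI[of _ "a + padic_p ^ Suc s * b"]) auto
  qed
  then obtain a where a: "\<And>s. approx s (a s)" "\<And>s. padic_p ^ Suc s dvd a (Suc s) - a s"
    by blast
  \<comment> \<open>The index is shifted because \<open>a s\<close> is already accurate modulo
    p^(s+1); at n = 0 the claim is divisibility by 1.\<close>
  have "padic_p ^ n dvd (\<lambda>n. a (n - 1)) (Suc n) - (\<lambda>n. a (n - 1)) n" for n
    using a(2) by (cases n) auto
  then obtain \<alpha> where \<alpha>: "\<And>n. padic_p ^ n dvd \<alpha> - a (n - 1)"
    by (rule padic_int_Cauchy_limit) blast
  have "\<exists>v\<in>?M. \<forall>k. H (Suc s) k = \<alpha> * H s k + padic_p ^ Suc s * v k" for s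
  proof -
    obtain v where v: "v \<in> ?M" "\<And>k. H (Suc s) k = a s * H s k + padic_p ^ Suc s * v k"
      using a(1)[of s] unfolding approx_def by blast
    obtain t where t: "\<alpha> - a s = padic_p ^ Suc s * t"
      using \<alpha>[of "Suc s"] by (auto elim: dvdE)
    have "H (Suc s) k = \<alpha> * H s k + padic_p ^ Suc s * (1 * v k + (- t) * H s k)" for k
    proof -
      have "H (Suc s) k = \<alpha> * H s k - (\<alpha> - a s) * H s k + padic_p ^ Suc s * v k"
        unfolding v(2) by (simp add: left_diff_distrib)
      then show ?thesis
        unfolding t by (simp add: algebra_simps)
    qed
    moreover have "(\<lambda>k. 1 * v k + (- t) * H s k) \<in> ?M"
      using v(1) H_M by (rule twisted_lipschitz_add)
    ultimately show ?thesis
      by (intro bexI[of _ "\<lambda>k. 1 * v k + (- t) * H s k"]) blast+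
  qed
  then obtain v where v: "\<And>s. v s \<in> ?M"
    "\<And>s k. H (Suc s) k = \<alpha> * H s k + padic_p ^ Suc s * v s k"
    by metis
  have "?U (v s) k = padic_p * v (Suc s) k" for s k
  proof -
    have eq: "H (Suc s) = (\<lambda>k. \<alpha> * H s k + padic_p ^ Suc s * v s k)"
      using v(2) by blast
    have "H (Suc (Suc s)) k = \<alpha> * H (Suc s) k + padic_p ^ Suc s * ?U (v s) k"
      by (subst H_Suc, subst eq, subst dwork_op_add) (simp add: H_Suc)
    then have "padic_p ^ Suc s * ?U (v s) k = padic_p ^ Suc s * (padic_p * v (Suc s) k)"
      using v(2)[of "Suc s" k] by (simp add: ac_simps)
    then show ?thesis
      using CARD_nonzero[where 'p = 'p] by (simp only: mult_cancel_left) simp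
  qed
  moreover have "?U (\<lambda>k. z ^ k) k = \<alpha> * z ^ k + padic_p * v 0 k" for k
    using v(2)[of 0 k] by (simp add: H_Suc H_0)
  moreover have "\<alpha> dvd 1"
  proof (rule padic_int_unit)
    show "\<not> padic_p dvd \<alpha>"
      using calculation(2)[of 0] unit by (metis dvd_add dvd_mult2 dvd_triv_left)
  qed
  ultimately show ?thesis
    using that v(1) by blast
qed

text \<open>Replacing \<open>S (Suc s)\<close> by \<open>S s\<close> costs p^(s+1) and applies U,
  which extracts a factor p from every \<open>v j\<close>. Hence \<open>S s (v j)\<close> is
  divisible by p^s, and the defect \<open>padic_p * S s (v 0)\<close> is as small as the
  cost.\<close>

lemma dwork_congruence:
  fixes S :: "nat \<Rightarrow> (nat \<Rightarrow> 'p::prime_card padic_int) \<Rightarrow> 'p padic_int"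
  assumes lin: "\<And>s a b f f'. S s (\<lambda>k. a * f k + b * f' k) = a * S s f + b * S s f'"
    and S: "\<And>s f. padic_p ^ Suc s dvd S (Suc s) f - S s (dwork_op g f)"
    and U: "\<And>k. dwork_op g h k = \<alpha> * h k + padic_p * v 0 k"
      "\<And>j k. dwork_op g (v j) k = padic_p * v (Suc j) k"
  shows "padic_p ^ Suc s dvd S (Suc s) h - \<alpha> * S s h"
proof -
  have v: "padic_p ^ s dvd S s (v j)" for s j
  proof (induction s arbitrary: j)
    case (Suc s)
    have "dwork_op g (v j) = (\<lambda>k. padic_p * v (Suc j) k + 0 * v j k)"
      using U(2) by auto
    then have "S s (dwork_op g (v j)) = padic_p * S s (v (Suc j))"
      by (simp only: lin) simp
    then have "padic_p ^ Suc s dvd S s (dwork_op g (v j))"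
      using Suc by simp
    then show ?case
      using S by (metis diff_add_cancel dvd_add)
  qed simp
  have "dwork_op g h = (\<lambda>k. \<alpha> * h k + padic_p * v 0 k)"
    using U(1) by auto
  then have "S s (dwork_op g h) = \<alpha> * S s h + padic_p * S s (v 0)"
    by (simp only: lin)
  then have "S (Suc s) h - \<alpha> * S s h = (S (Suc s) h - S s (dwork_op g h)) + padic_p * S s (v 0)"
    by simp
  then show ?thesis
    using S v[of s 0] by (metis dvd_add dvd_refl mult_dvd_mono power_Suc)
qed

text \<open>Letting \<open>x\<close> vary with s covers both families, x_s = -1/2 and x_s = n_s. The
  operator is formed with the limit \<open>y\<close>, hence is the same at all levels; passing to
  x_(s+1) changes the quotients only by multiples of p^(s+1).\<close>

lemma dwork_functional:
  fixes x :: "nat \<Rightarrow> 'p::prime_card padic_int"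
  assumes n: "\<And>s. n (Suc s) = CARD('p) * n s + h" and h: "h < CARD('p)"
    and x: "\<And>s. x (Suc s) = padic_p * x s + of_nat h"
    and xy: "\<And>s. padic_p ^ s dvd x s - y" and xn: "\<And>s. padic_p ^ s dvd x s - of_nat (n s)"
    and A: "\<And>s. binomial_seq (x s) (A s)" and r: "r \<ge> 1"
  shows "padic_p ^ Suc s dvd (\<Sum>k\<le>n (Suc s). A (Suc s) k ^ r * f k) -
    (\<Sum>k\<le>n s. A s k ^ r * dwork_op (\<lambda>K. binomial_quot h y K ^ r) f k)"
proof -
  let ?p = "CARD('p)" and ?d = "padic_p ^ Suc s :: 'p padic_int"
  let ?g = "\<lambda>K. A (Suc s) K ^ r * f K"
  have quot: "A (Suc s) K = A s (K div ?p) * binomial_quot h (x (Suc s)) K" for K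
    by (rule binomial_seq_quot[OF x h A A])
  have "?d dvd (\<Sum>k\<le>n s. A s k ^ r * dwork_op (\<lambda>K. binomial_quot h y K ^ r) f k) -
      (\<Sum>k\<le>n s. A s k ^ r * dwork_op (\<lambda>K. binomial_quot h (x (Suc s)) K ^ r) f k)"
    unfolding dwork_op_def
    by (intro dvd_diff_sum dvd_diff_mult dvd_diff_refl dvd_diff_power binomial_quot_cong)
      (rule dvd_diff_sym[OF xy])
  also have "(\<Sum>k\<le>n s. A s k ^ r * dwork_op (\<lambda>K. binomial_quot h (x (Suc s)) K ^ r) f k)
      = (\<Sum>k<Suc (n s). \<Sum>i<?p. ?g (k * ?p + i))"
    unfolding dwork_op_def sum_distrib_left lessThan_Suc_atMost
    by (intro sum.cong refl) (auto simp: quot power_mult_distrib ac_simps)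
  also have "\<dots> = (\<Sum>k<Suc (n s). sum ?g {k * ?p..<k * ?p + ?p})"
    unfolding sum.atLeastLessThan_shift_0[of ?g] by (simp add: atLeast0LessThan)
  also have "\<dots> = sum ?g {..<Suc (n s) * ?p}"
    by (rule sum.nat_group)
  also have "{..<Suc (n s) * ?p} = {..n (Suc s)} \<union> {n (Suc s)<..<Suc (n s) * ?p}"
    using h by (auto simp: n algebra_simps)
  also have "sum ?g \<dots> = sum ?g {..n (Suc s)} + sum ?g {n (Suc s)<..<Suc (n s) * ?p}"
    by (rule sum.union_disjoint) auto
  finally have 1: "?d dvd (\<Sum>k\<le>n s. A s k ^ r * dwork_op (\<lambda>K. binomial_quot h y K ^ r) f k) -
      (sum ?g {..n (Suc s)} + sum ?g {n (Suc s)<..<Suc (n s) * ?p})" .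
  \<comment> \<open>The last block of p indices overshoots n_(s+1). There the digit exceeds h, and
    the surplus factor of \<open>binomial_quot\<close> is x_(s+1) - n_(s+1), divisible by
    p^(s+1).\<close>
  have "?d dvd sum ?g {n (Suc s)<..<Suc (n s) * ?p}"
  proof (rule dvd_sum)
    fix K assume K: "K \<in> {n (Suc s)<..<Suc (n s) * ?p}"
    define i where "i = K - ?p * n s"
    have i: "K = ?p * n s + i" "h < i" "i < ?p"
      using K by (auto simp: i_def n algebra_simps)
    then have "K div ?p = n s" "K mod ?p = i"
      by simp_all
    then have "binomial_quot h (x (Suc s)) K = (x (Suc s) - of_nat (n (Suc s))) *
        (unit_prod (\<lambda>i. x (Suc s) - of_nat i) K * uinv (unit_prod (\<lambda>i. of_nat (Suc i)) K))"
      using i by (simp add: binomial_quot_def n add.commute mult.assoc)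
    then have "?d dvd A (Suc s) K"
      unfolding quot using xn[of "Suc s"] by (metis dvd_mult dvd_mult2)
    then have "?d dvd A (Suc s) K ^ r"
      using r by (metis dvd_trans dvd_power not_one_le_zero gr0I)
    then show "?d dvd ?g K"
      by (rule dvd_mult2)
  qed
  from dvd_diff[OF dvd_diff_sym[OF 1] this] show ?thesis
    by simp
qed

section \<open>Embedding into the field of \<open>p\<close>-adic numbers\<close>

lemma of_padic_int_simps [simp]:
  "of_padic_int 0 = (0 :: 'p::prime_card padic)"
  "of_padic_int 1 = (1 :: 'p padic)"
  "of_padic_int (a + b) = (of_padic_int a + of_padic_int b :: 'p padic)"
  "of_padic_int (- a) = (- of_padic_int a :: 'p padic)"
  "of_padic_int (a - b) = (of_padic_int a - of_padic_int b :: 'p padic)"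
  "of_padic_int (a * b) = (of_padic_int a * of_padic_int b :: 'p padic)"
  "of_padic_int (of_nat n) = (of_nat n :: 'p padic)"
  by (simp_all add: of_padic_int_def Zero_fract_def One_fract_def of_nat_fract)

lemma of_padic_int_power [simp]: "of_padic_int (a ^ n) = of_padic_int a ^ n"
  by (induction n) simp_all

lemma of_padic_int_sum [simp]: "of_padic_int (sum f A) = (\<Sum>x\<in>A. of_padic_int (f x))"
  by (induction A rule: infinite_finite_induct) simp_all

lemma of_padic_int_prod [simp]: "of_padic_int (prod f A) = (\<Prod>x\<in>A. of_padic_int (f x))"
  by (induction A rule: infinite_finite_induct) simp_all

lemma of_padic_int_fact [simp]: "of_padic_int (fact n :: 'p::prime_card padic_int) = fact n"
  by (metis of_nat_fact of_padic_int_simps(7))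

lemma of_padic_int_eq_iff [simp]: "of_padic_int a = of_padic_int b \<longleftrightarrow> a = b"
  by (simp add: of_padic_int_def eq_fract)

lemma of_padic_int_eq_0_iff [simp]: "of_padic_int a = 0 \<longleftrightarrow> a = 0"
  using of_padic_int_eq_iff[of a 0] by (simp del: of_padic_int_eq_iff)

lemma padic_ord_ge:
  "x = of_nat CARD('p) powi e * of_padic_int (z :: 'p::prime_card padic_int) \<Longrightarrow>
    ereal (real_of_int e) \<le> padic_ord x"
  unfolding padic_ord_def by (rule SUP_upper) blast

lemma padic_ord_0: "padic_ord (0 :: 'p::prime_card padic) = \<infinity>"
proof -
  have "ereal (real n) \<le> padic_ord (0 :: 'p padic)" for n
    using padic_ord_ge[of 0 "int n" 0] by simp
  then show ?thesis
    by (metis ereal_less_eq(1) ereal_infty_less(1) less_PInf_Ex_of_nat linorder_not_le order_less_imp_le)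
qed

lemma padic_cong_0_1_of_dvd:
  assumes "padic_p dvd (a :: 'p::prime_card padic_int)"
  shows "padic_cong (of_padic_int a) 0 1"
proof -
  from assms obtain b where "a = padic_p * b" ..
  then show ?thesis
    using padic_ord_ge[of "of_padic_int a" 1 b] by (simp add: padic_cong_def one_ereal_def)
qed

text \<open>If \<open>b = 0\<close>, then \<open>D = \<infinity>\<close> and the congruence is void, whatever the value of \<open>a / 0\<close>.\<close>

lemma padic_cong_divide:
  fixes a b \<alpha> :: "'p::prime_card padic_int"
  assumes dvd: "padic_p ^ s dvd a - \<alpha> * b" and D: "padic_ord (of_padic_int b) \<le> D"
  shows "padic_cong (of_padic_int a / of_padic_int b) (of_padic_int \<alpha>) (ereal (real s) - D)"
proof (cases "b = 0")
  case True
  then have "D = \<infinity>"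
    using D by (simp add: padic_ord_0)
  then show ?thesis
    by (simp add: padic_cong_def)
next
  case False
  then obtain d u where u: "b = padic_p ^ d * u" "u dvd 1"
    by (rule padic_int_eq_power_times_unit)
  from dvd obtain z where z: "a - \<alpha> * b = padic_p ^ s * z" ..
  let ?q = "of_nat CARD('p) :: 'p padic"
  have q: "?q \<noteq> 0"
    using CARD_prime_card_pos[where 'p = 'p] by simp
  have "of_padic_int u * of_padic_int (uinv u) = (1 :: 'p padic)"
    using mult_uinv[OF u(2)] by (metis of_padic_int_simps(2,6))
  then have inv: "of_padic_int (uinv u) = 1 / (of_padic_int u :: 'p padic)"
    by (metis mult_zero_left nonzero_mult_div_cancel_left zero_neq_one)
  have "of_padic_int a / of_padic_int b - of_padic_int \<alpha> = of_padic_int (a - \<alpha> * b) / (of_padic_int b :: 'p padic)"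
    using False by (simp add: field_simps)
  also have "\<dots> = ?q ^ s / ?q ^ d * of_padic_int (z * uinv u)"
    unfolding z by (simp add: u(1) inv)
  also have "?q ^ s / ?q ^ d = ?q powi (int s - int d)"
    using q by (simp add: power_int_diff)
  finally have "ereal (real_of_int (int s - int d)) \<le>
      padic_ord (of_padic_int a / of_padic_int b - of_padic_int \<alpha>)"
    by (rule padic_ord_ge)
  moreover have "ereal (real d) \<le> padic_ord (of_padic_int b)"
    using padic_ord_ge[of "of_padic_int b" "int d" u] by (simp add: u(1))
  with D have "ereal (real d) \<le> D"
    by simp
  then have "ereal (real s) - D \<le> ereal (real s) - ereal (real d)"
    by (intro ereal_minus_mono) simp_all
  ultimately show ?thesis
    unfolding padic_cong_def by (simp add: order_trans)
qed

section \<open>The two families of truncated sums\<close>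

lemma fact_times_binomial:
  "fact k * of_nat (n choose k) = (\<Prod>i<k. of_nat n - of_nat i :: 'a::{comm_ring_1, ring_char_0})"
proof (induction k)
  case (Suc k)
  have *: "of_nat (Suc k) * of_nat (n choose Suc k) = (of_nat n - of_nat k) * (of_nat (n choose k) :: 'a)"
  proof (cases "k \<le> n")
    case True
    have "Suc k * (n choose Suc k) = (n - k) * (n choose k)"
      by (metis Suc_times_binomial_eq binomial_absorb_comp binomial_absorption mult.commute diff_Suc_1 binomial_eq_0_iff Suc_times_binomial)
    then have "of_nat (Suc k * (n choose Suc k)) = (of_nat ((n - k) * (n choose k)) :: 'a)"
      by (rule arg_cong)
    then show ?thesis
      using True by (simp only: of_nat_mult of_nat_diff)
  qed (simp add: binomial_eq_0)
  have "fact (Suc k) * of_nat (n choose Suc k) = fact k * (of_nat (Suc k) * of_nat (n choose Suc k) :: 'a)"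
    by (simp only: fact_Suc ac_simps)
  also have "\<dots> = (of_nat n - of_nat k) * (fact k * of_nat (n choose k))"
    unfolding * by (simp only: ac_simps)
  finally show ?case
    by (simp add: Suc mult.commute)
qed simp

lemma binomial_seq_of_nat: "binomial_seq (of_nat n) (\<lambda>k. of_nat (n choose k))"
  by (simp add: binomial_seq_def fact_times_binomial)

text \<open>Integrality depends only on the power of p in k!. Modulo that power x may be replaced by
  a natural number, whose binomial coefficients are integers.\<close>

lemma binomial_seq_exists:
  fixes x :: "'p::prime_card padic_int"
  obtains A where "binomial_seq x A"
proof -
  have "fact k dvd (\<Prod>i<k. x - of_nat i)" for k
  proof -
    obtain d u where u: "(fact k :: 'p padic_int) = padic_p ^ d * u" "u dvd 1"
      using fact_nonzero padic_int_eq_power_times_unit by metis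
    obtain n where n: "padic_p ^ d dvd x - of_nat n"
      by (rule padic_int_approx_nat)
    have "padic_p ^ d dvd (\<Prod>i<k. x - of_nat i) - (\<Prod>i<k. of_nat n - of_nat i)"
      by (rule dvd_diff_prod) (use n in simp)
    moreover have "padic_p ^ d dvd (\<Prod>i<k. of_nat n - of_nat i :: 'p padic_int)"
      unfolding fact_times_binomial[symmetric] u(1) by (simp add: mult.assoc)
    ultimately have "padic_p ^ d dvd (\<Prod>i<k. x - of_nat i)"
      by (metis diff_add_cancel dvd_add)
    then obtain b where b: "(\<Prod>i<k. x - of_nat i) = padic_p ^ d * b" ..
    have "(\<Prod>i<k. x - of_nat i) = padic_p ^ d * (u * uinv u) * b"
      by (simp add: b mult_uinv[OF u(2)])
    then show ?thesis
      unfolding u(1) by (metis dvd_triv_left mult.assoc)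
  qed
  then have "\<forall>k. \<exists>b. fact k * b = (\<Prod>i<k. x - of_nat i)"
    unfolding dvd_def by metis
  from choice[OF this] show ?thesis
    using that unfolding binomial_seq_def by blast
qed

lemma truncated_sum_congruences:
  fixes A :: "nat \<Rightarrow> 'p::prime_card padic_int" and z :: "'p padic_int" and r :: nat
  defines "n m s \<equiv> (m * CARD('p) ^ s - 1) div 2"
  defines "F N \<equiv> \<Sum>k\<le>N. A k ^ r * z ^ k"
    and "B N \<equiv> \<Sum>k\<le>N. of_nat (N choose k) ^ r * z ^ k"
  assumes p: "odd CARD('p)" and r: "r \<ge> 1" and y: "2 * y = - 1" and A: "binomial_seq y A"
    and unit: "\<not> padic_p dvd F ((CARD('p) - 1) div 2)"
  obtains \<alpha> where "\<alpha> dvd 1"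
    "\<And>m s. odd m \<Longrightarrow> padic_p ^ Suc s dvd F (n m (Suc s)) - \<alpha> * F (n m s)"
    "\<And>m s. odd m \<Longrightarrow> padic_p ^ Suc s dvd B (n m (Suc s)) - \<alpha> * B (n m s)"
proof -
  define h where "h = (CARD('p) - 1) div 2"
  have h2: "CARD('p) = 2 * h + 1"
    using p by (auto simp: h_def elim: oddE)
  then have h: "h < CARD('p)" by simp
  \<comment> \<open>-1/2 is the fixed point of x \<mapsto> p x + h, so the first family keeps the
    same x at every level.\<close>
  have y_rec: "y = padic_p * y + of_nat h"
  proof -
    have "2 * (padic_p * y + of_nat h) = padic_p * (2 * y) + 2 * of_nat h"
      by (simp add: algebra_simps)
    also have "\<dots> = 2 * y"
      unfolding y h2 by simp
    finally show ?thesis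
      by (metis mult_left_cancel zero_neq_numeral)
  qed
  have n2: "2 * n m s + 1 = m * CARD('p) ^ s" if "odd m" for m s
    using that p unfolding n_def by (auto elim!: oddE)
  have n_Suc: "n m (Suc s) = CARD('p) * n m s + h" if "odd m" for m s
  proof -
    have "2 * n m (Suc s) + 1 = CARD('p) * (2 * n m s + 1)"
      unfolding n2[OF that] by simp
    then have "2 * n m (Suc s) = 2 * (CARD('p) * n m s) + (CARD('p) - 1)"
      using h2 by (simp add: algebra_simps)
    then show ?thesis
      using h2 by simp
  qed
  have two: "(2 :: 'p padic_int) dvd 1"
    using y by (metis dvd_triv_left dvd_minus_iff)
  have yn: "padic_p ^ s dvd y - of_nat (n m s)" if "odd m" for m s
  proof -
    have "2 * (y - of_nat (n m s)) = - of_nat (2 * n m s + 1)"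
      by (simp add: right_diff_distrib y)
    also have "\<dots> = padic_p ^ s * (- of_nat m)"
      unfolding n2[OF that] by (simp add: mult.commute)
    finally show ?thesis
      using two by (metis dvd_triv_left unit_dvd_cancel)
  qed
  define g where "g K = binomial_quot h y K ^ r" for K
  have g: "padic_p ^ Suc j dvd g (k + CARD('p) ^ Suc j) - g k" for j k
    unfolding g_def by (rule dvd_diff_power) (rule binomial_quot_period)
  define S where "S m s f = (\<Sum>k\<le>n m s. A k ^ r * f k)" for m s f
  define T where "T m s f = (\<Sum>k\<le>n m s. of_nat (n m s choose k) ^ r * f k)" for m s and f :: "nat \<Rightarrow> 'p padic_int"
  have S: "padic_p ^ Suc s dvd S m (Suc s) f - S m s (dwork_op g f)" if "odd m" for m s f
    unfolding S_def g_def
    by (rule dwork_functional[where x = "\<lambda>s. y" and A = "\<lambda>s. A"])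
      (simp_all add: n_Suc[OF that] h y_rec[symmetric] yn[OF that] A Suc_leI[OF r[unfolded One_nat_def Suc_le_eq]])
  have T: "padic_p ^ Suc s dvd T m (Suc s) f - T m s (dwork_op g f)" if "odd m" for m s f
    unfolding T_def g_def
    by (rule dwork_functional[where x = "\<lambda>s. of_nat (n m s)" and A = "\<lambda>s k. of_nat (n m s choose k)"])
      (simp_all add: n_Suc[OF that] h dvd_diff_sym[OF yn[OF that]] binomial_seq_of_nat Suc_leI[OF r[unfolded One_nat_def Suc_le_eq]])
  \<comment> \<open>\<open>S 1 0\<close> is evaluation at 0, while \<open>S 1 1\<close> sends z^k to
    F at (p - 1)/2; the two levels are compared modulo p.\<close>
  have "\<not> padic_p dvd dwork_op g (\<lambda>k. z ^ k) 0"
  proof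
    assume "padic_p dvd dwork_op g (\<lambda>k. z ^ k) 0"
    moreover have "A 0 = 1"
      using A by (auto simp: binomial_seq_def dest: spec[of _ 0])
    moreover have "n 1 0 = 0"
      by (simp add: n_def)
    ultimately have "padic_p dvd S 1 0 (dwork_op g (\<lambda>k. z ^ k))"
      by (simp add: S_def)
    moreover have "padic_p ^ Suc 0 dvd S 1 (Suc 0) (\<lambda>k. z ^ k) - S 1 0 (dwork_op g (\<lambda>k. z ^ k))"
      by (rule S) simp
    ultimately have "padic_p dvd S 1 (Suc 0) (\<lambda>k. z ^ k)"
      by (metis diff_add_cancel dvd_add power_one_right One_nat_def)
    then show False
      using unit by (simp add: S_def F_def n_def)
  qed
  from dwork_unit_root[OF g this] obtain \<alpha> v where \<alpha>: "\<alpha> dvd 1"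
    and v: "\<And>k. dwork_op g (\<lambda>k. z ^ k) k = \<alpha> * z ^ k + padic_p * v 0 k"
      "\<And>j k. dwork_op g (v j) k = padic_p * v (Suc j) k"
    by metis
  show ?thesis
  proof (rule that)
    show "\<alpha> dvd 1" by fact
    fix m s :: nat assume m: "odd m"
    have "padic_p ^ Suc s dvd S m (Suc s) (\<lambda>k. z ^ k) - \<alpha> * S m s (\<lambda>k. z ^ k)"
      by (rule dwork_congruence[where S = "S m" and h = "\<lambda>k. z ^ k" and v = v, OF _ S[OF m] v])
        (simp add: S_def sum.distrib sum_distrib_left algebra_simps)
    then show "padic_p ^ Suc s dvd F (n m (Suc s)) - \<alpha> * F (n m s)"
      by (simp only: S_def F_def)
    have "padic_p ^ Suc s dvd T m (Suc s) (\<lambda>k. z ^ k) - \<alpha> * T m s (\<lambda>k. z ^ k)"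
      by (rule dwork_congruence[where S = "T m" and h = "\<lambda>k. z ^ k" and v = v, OF _ T[OF m] v])
        (simp add: T_def sum.distrib sum_distrib_left algebra_simps)
    then show "padic_p ^ Suc s dvd B (n m (Suc s)) - \<alpha> * B (n m s)"
      by (simp only: T_def B_def)
  qed
qed

text \<open>The quotient (1/2)_k / k! is (-1)^k times \<open>-1/2 choose k\<close>; the signs of the
  r-th powers are absorbed into (-1)^r \<lambda>.\<close>

lemma F_trunc_eq:
  fixes lam :: "'p::prime_card padic_int"
  assumes y: "2 * y = - 1" and A: "binomial_seq y A"
  shows "F_trunc r (of_padic_int lam) N = of_padic_int (\<Sum>k\<le>N. A k ^ r * ((- 1) ^ r * lam) ^ k)"
proof -
  have "of_padic_int (2 * y) = of_padic_int (- 1 :: 'p padic_int)"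
    by (simp only: y)
  then have "2 * of_padic_int y = (- 1 :: 'p padic)"
    using of_padic_int_simps(7)[where 'p = 'p and n = 2] by simp
  then have y': "of_padic_int y = (- (1 / 2) :: 'p padic)"
    by (simp add: field_simps)
  have "pochhammer (1 / 2) k / fact k = (- 1) ^ k * (of_padic_int (A k) :: 'p padic)" for k
  proof -
    have "fact k * of_padic_int (A k) = (\<Prod>i<k. of_padic_int y - of_nat i :: 'p padic)"
      using arg_cong[OF A[unfolded binomial_seq_def, rule_format, of k], of of_padic_int] by simp
    also have "\<dots> = (\<Prod>i<k. - (1 / 2 + of_nat i))"
      unfolding y' by simp
    also have "\<dots> = (- 1) ^ k * pochhammer (1 / 2) k"
      by (simp only: prod_uminus pochhammer_prod) (simp add: atLeast0LessThan)
    finally have "(- 1) ^ k * (fact k * of_padic_int (A k)) = (- 1) ^ k * ((- 1) ^ k * pochhammer (1 / 2) k :: 'p padic)"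
      by (rule arg_cong)
    also have "\<dots> = pochhammer (1 / 2) k"
      by (simp flip: power_mult_distrib mult.assoc)
    finally show ?thesis
      by (simp add: field_simps)
  qed
  moreover have "((- 1) ^ k * a) ^ r * l ^ k = a ^ r * ((- 1) ^ r * l) ^ k" for a l :: "'p padic" and k
    by (simp add: power_mult_distrib mult.commute[of r k] algebra_simps flip: power_mult)
  ultimately show ?thesis
    by (simp add: F_trunc_def)
qed

lemma stienstra_coeff_eq:
  fixes lam :: "'p::prime_card padic_int"
  assumes "r \<ge> 1"
  shows "stienstra_coeff r (of_padic_int lam) N =
    of_padic_int (\<Sum>k\<le>N. of_nat (N choose k) ^ r * ((- 1) ^ r * lam) ^ k)"
  using assms by (simp add: stienstra_coeff_binomial)

section \<open>Substitution into power series in two variables\<close>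

lemma coeff2_fps2 [simp]: "coeff2 (fps2 c) i j = c i j"
  by (simp add: coeff2_def fps2_def)

lemma fps_fps_eqI: "(\<And>i j. coeff2 G i j = coeff2 H i j) \<Longrightarrow> G = H"
  by (simp add: coeff2_def fps_eq_iff)

lemma coeff2_1: "coeff2 (1 :: 'a::comm_ring_1 fps fps) i j = (if i = 0 \<and> j = 0 then 1 else 0)"
  by (simp add: coeff2_def)

lemma coeff2_add [simp]: "coeff2 (G + H) i j = coeff2 G i j + coeff2 (H :: 'a::comm_ring_1 fps fps) i j"
  by (simp add: coeff2_def)

lemma coeff2_diff [simp]: "coeff2 (G - H) i j = coeff2 G i j - coeff2 (H :: 'a::comm_ring_1 fps fps) i j"
  by (simp add: coeff2_def)

lemma coeff2_sum [simp]: "coeff2 (sum G A :: 'a::comm_ring_1 fps fps) i j = (\<Sum>x\<in>A. coeff2 (G x) i j)"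
  by (simp add: coeff2_def fps_sum_nth)

lemma coeff2_scale [simp]:
  "coeff2 (fps_const (fps_const c) * G) i j = c * coeff2 (G :: 'a::comm_ring_1 fps fps) i j"
  by (simp add: coeff2_def)

lemma coeff2_mult:
  "coeff2 (G * H :: 'a::comm_ring_1 fps fps) i j =
    (\<Sum>b\<le>j. \<Sum>a\<le>i. coeff2 G a b * coeff2 H (i - a) (j - b))"
  by (simp add: coeff2_def fps_mult_nth fps_sum_nth atLeast0AtMost)

lemma coeff2_power_eq_0:
  fixes G :: "'a::comm_ring_1 fps fps"
  assumes "coeff2 G 0 0 = 0"
  shows "i + j < k \<Longrightarrow> coeff2 (G ^ k) i j = 0"
proof (induction k arbitrary: i j)
  case (Suc k)
  have "coeff2 G a b * coeff2 (G ^ k) (i - a) (j - b) = 0" if "a \<le> i" "b \<le> j" for a b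
  proof (cases "a = 0 \<and> b = 0")
    case False
    then have "(i - a) + (j - b) < k"
      using that Suc.prems by auto
    then show ?thesis
      using Suc.IH by simp
  qed (use assms in simp)
  then show ?case
    by (simp add: coeff2_mult)
qed simp

lemma coeff2_mult_cong:
  fixes G H :: "'a::comm_ring_1 fps fps"
  assumes "\<And>a b. a \<le> i \<Longrightarrow> b \<le> j \<Longrightarrow> coeff2 G a b = coeff2 G' a b"
    and "\<And>a b. a \<le> i \<Longrightarrow> b \<le> j \<Longrightarrow> coeff2 H a b = coeff2 H' a b"
  shows "coeff2 (G * H) i j = coeff2 (G' * H') i j"
  unfolding coeff2_mult by (intro sum.cong refl) (simp add: assms)

lemma coeff2_compose_outer2:
  fixes G :: "'a::comm_ring_1 fps fps"
  assumes "coeff2 G 0 0 = 0" and "i + j \<le> N"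
  shows "coeff2 (compose_outer2 f G) i j = (\<Sum>k\<le>N. fps_nth f k * coeff2 (G ^ k) i j)"
  unfolding compose_outer2_def coeff2_fps2
  by (rule sum.mono_neutral_left) (use assms in \<open>auto simp: coeff2_power_eq_0\<close>)

text \<open>Up to total degree N only the powers G^k with k \<le> N matter, so series become
  polynomials in G; the products with k + l > N vanish, which leaves the Cauchy product.\<close>

lemma compose_outer2_mult:
  fixes G :: "'a::comm_ring_1 fps fps"
  assumes G: "coeff2 G 0 0 = 0"
  shows "compose_outer2 (f * g) G = compose_outer2 f G * compose_outer2 g G"
proof (rule fps_fps_eqI)
  fix i j :: nat
  define N where "N = i + j"
  let ?T = "\<lambda>f. \<Sum>k\<le>N. fps_const (fps_const (fps_nth f k)) * G ^ k"
  have T: "coeff2 (compose_outer2 f G) a b = coeff2 (?T f) a b" if "a \<le> i" "b \<le> j" for f a b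
    using coeff2_compose_outer2[OF G, of a b N f] that by (simp add: N_def)
  have "coeff2 (compose_outer2 f G * compose_outer2 g G) i j = coeff2 (?T f * ?T g) i j"
    by (rule coeff2_mult_cong) (rule T; assumption)+
  also have "?T f * ?T g = (\<Sum>k\<le>N. \<Sum>l\<le>N. fps_const (fps_const (fps_nth f k * fps_nth g l)) * G ^ (k + l))"
    unfolding sum_product
    by (intro sum.cong refl) (simp add: power_add ac_simps flip: fps_const_mult)
  also have "coeff2 \<dots> i j = (\<Sum>(k, l)\<in>{..N} \<times> {..N}. fps_nth f k * fps_nth g l * coeff2 (G ^ (k + l)) i j)"
    by (simp only: coeff2_sum coeff2_scale) (simp add: sum.cartesian_product)
  also have "\<dots> = (\<Sum>(k, l)\<in>{(k, l). k + l \<le> N}. fps_nth f k * fps_nth g l * coeff2 (G ^ (k + l)) i j)"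
  proof (rule sum.mono_neutral_right)
    have "coeff2 (G ^ k) i j = 0" if "\<not> k \<le> N" for k
      using that by (intro coeff2_power_eq_0[OF G]) (simp add: N_def)
    then show "\<forall>x\<in>{..N} \<times> {..N} - {(k, l). k + l \<le> N}.
        (case x of (k, l) \<Rightarrow> fps_nth f k * fps_nth g l * coeff2 (G ^ (k + l)) i j) = 0"
      by fastforce
  qed auto
  also have "\<dots> = (\<Sum>m\<le>N. \<Sum>k\<le>m. fps_nth f k * fps_nth g (m - k) * coeff2 (G ^ (k + (m - k))) i j)"
    by (rule sum.triangle_reindex_eq)
  also have "\<dots> = (\<Sum>m\<le>N. fps_nth (f * g) m * coeff2 (G ^ m) i j)"
    by (intro sum.cong refl) (simp add: fps_mult_nth sum_distrib_right atLeast0AtMost)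
  also have "\<dots> = coeff2 (compose_outer2 (f * g) G) i j"
    by (rule coeff2_compose_outer2[OF G, symmetric]) (simp add: N_def)
  finally show "coeff2 (compose_outer2 (f * g) G) i j = coeff2 (compose_outer2 f G * compose_outer2 g G) i j"
    by simp
qed

lemma compose_outer2_1: "compose_outer2 1 G = (1 :: 'a::comm_ring_1 fps fps)"
proof (rule fps_fps_eqI)
  fix i j :: nat
  have "(\<Sum>k\<le>i + j. fps_nth 1 k * coeff2 (G ^ k) i j) = (\<Sum>k\<in>{0}. coeff2 (G ^ k) i j)"
    by (rule sum.mono_neutral_cong_right) auto
  then show "coeff2 (compose_outer2 1 G) i j = coeff2 1 i j"
    by (simp add: compose_outer2_def)
qed

lemma compose_outer2_power:
  "coeff2 (G :: 'a::comm_ring_1 fps fps) 0 0 = 0 \<Longrightarrow> compose_outer2 (f ^ n) G = compose_outer2 f G ^ n"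
  by (induction n) (simp_all add: compose_outer2_1 compose_outer2_mult)

lemma compose_outer2_0_0: "coeff2 (compose_outer2 f G) 0 0 = fps_nth (f :: 'a::comm_ring_1 fps) 0"
  by (simp add: compose_outer2_def coeff2_1)

lemma compose_outer2_compose:
  fixes G :: "'a::comm_ring_1 fps fps"
  assumes G: "coeff2 G 0 0 = 0" and g: "fps_nth g 0 = 0"
  shows "compose_outer2 (f oo g) G = compose_outer2 f (compose_outer2 g G)"
proof (rule fps_fps_eqI)
  fix i j :: nat
  define N where "N = i + j"
  have "coeff2 (compose_outer2 f (compose_outer2 g G)) i j
      = (\<Sum>k\<le>N. fps_nth f k * coeff2 (compose_outer2 (g ^ k) G) i j)"
    unfolding compose_outer2_power[OF G]
    by (rule coeff2_compose_outer2) (simp_all add: N_def compose_outer2_0_0 g)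
  also have "\<dots> = (\<Sum>k\<le>N. \<Sum>m\<le>N. fps_nth f k * fps_nth (g ^ k) m * coeff2 (G ^ m) i j)"
    by (simp add: coeff2_compose_outer2[OF G, of i j N] N_def sum_distrib_left mult.assoc)
  also have "\<dots> = (\<Sum>m\<le>N. \<Sum>k\<le>N. fps_nth f k * fps_nth (g ^ k) m * coeff2 (G ^ m) i j)"
    by (rule sum.swap)
  also have "\<dots> = (\<Sum>m\<le>N. fps_nth (f oo g) m * coeff2 (G ^ m) i j)"
  proof (intro sum.cong refl)
    fix m assume "m \<in> {..N}"
    then have "(\<Sum>k\<le>N. fps_nth f k * fps_nth (g ^ k) m) = (\<Sum>k\<le>m. fps_nth f k * fps_nth (g ^ k) m)"
      by (intro sum.mono_neutral_right) (auto simp: startsby_zero_power_prefix[OF g])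
    then show "(\<Sum>k\<le>N. fps_nth f k * fps_nth (g ^ k) m * coeff2 (G ^ m) i j)
        = fps_nth (f oo g) m * coeff2 (G ^ m) i j"
      by (simp add: fps_compose_nth atLeast0AtMost flip: sum_distrib_right)
  qed
  also have "\<dots> = coeff2 (compose_outer2 (f oo g) G) i j"
    by (rule coeff2_compose_outer2[OF G, symmetric]) (simp add: N_def)
  finally show "coeff2 (compose_outer2 (f oo g) G) i j = coeff2 (compose_outer2 f (compose_outer2 g G)) i j"
    by simp
qed

lemma compose_outer2_X:
  fixes G :: "'a::comm_ring_1 fps fps"
  assumes "coeff2 G 0 0 = 0"
  shows "compose_outer2 fps_X G = G"
proof (rule fps_fps_eqI)
  fix i j :: nat
  have "coeff2 (compose_outer2 fps_X G) i j = (\<Sum>k\<le>Suc (i + j). fps_nth fps_X k * coeff2 (G ^ k) i j)"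
    by (rule coeff2_compose_outer2[OF assms]) simp
  also have "\<dots> = (\<Sum>k\<in>{1}. coeff2 (G ^ k) i j)"
    by (rule sum.mono_neutral_cong_right) auto
  finally show "coeff2 (compose_outer2 fps_X G) i j = coeff2 G i j"
    by simp
qed

section \<open>The formal group with a given logarithm\<close>

definition add2 :: "'a::comm_ring_1 fps \<Rightarrow> 'a fps fps" where
  "add2 l = fps2 (\<lambda>i j. (if j = 0 then fps_nth l i else 0) + (if i = 0 then fps_nth l j else 0))"

text \<open>The series f(y). As \<open>fps_const\<close> gives u(x), the products u(x) v(y) become
  available and \<open>add2 l\<close> is open to the binomial theorem.\<close>

definition outer_fps :: "'a::comm_ring_1 fps \<Rightarrow> 'a fps fps" where
  "outer_fps f = Abs_fps (\<lambda>j. fps_const (fps_nth f j))"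

lemma outer_fps_power: "outer_fps f ^ n = outer_fps (f ^ n)"
proof (induction n)
  case (Suc n)
  have "outer_fps f * outer_fps g = outer_fps (f * g)" for g
    by (simp add: outer_fps_def fps_eq_iff fps_mult_nth fps_sum_nth fps_nth_fps_const)
  then show ?case
    by (simp add: Suc)
qed (simp add: outer_fps_def fps_eq_iff)

lemma coeff2_const_times_outer: "coeff2 (fps_const u * outer_fps v) i j = fps_nth u i * fps_nth v j"
  by (simp add: coeff2_def outer_fps_def)

lemma coeff2_add2_power:
  "coeff2 (add2 l ^ k) i j =
    (\<Sum>a\<le>k. of_nat (k choose a) * fps_nth (l ^ a) i * fps_nth (l ^ (k - a)) j)"
proof -
  have "add2 l = fps_const l + outer_fps l"
    by (rule fps_fps_eqI) (simp only: add2_def coeff2_fps2 coeff2_add, simp add: coeff2_def outer_fps_def)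
  then have "add2 l ^ k = (\<Sum>a\<le>k. of_nat (k choose a) * (fps_const (l ^ a) * outer_fps (l ^ (k - a))))"
    by (simp add: binomial_ring outer_fps_power fps_const_power mult.assoc)
  then show ?thesis
    by (simp add: coeff2_const_times_outer mult.assoc flip: fps_of_nat)
qed

lemma add2_0_0: "fps_nth l 0 = 0 \<Longrightarrow> coeff2 (add2 l) 0 0 = 0"
  by (simp add: add2_def)

lemma coeff2_compose_add2:
  fixes l :: "'a::comm_ring_1 fps"
  assumes l: "fps_nth l 0 = 0"
  shows "coeff2 (compose_outer2 f (add2 l)) i j =
    (\<Sum>a\<le>i. \<Sum>b\<le>j. fps_nth f (a + b) * of_nat ((a + b) choose a) * fps_nth (l ^ a) i * fps_nth (l ^ b) j)"
proof -
  let ?t = "\<lambda>a b. fps_nth f (a + b) * of_nat ((a + b) choose a) * fps_nth (l ^ a) i * fps_nth (l ^ b) j"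
  have "coeff2 (compose_outer2 f (add2 l)) i j = (\<Sum>k\<le>i + j. \<Sum>a\<le>k. ?t a (k - a))"
    unfolding coeff2_compose_outer2[OF add2_0_0[OF l] order_refl] coeff2_add2_power sum_distrib_left
    by (intro sum.cong refl) (simp add: mult.assoc)
  also have "\<dots> = (\<Sum>(a, b)\<in>{(a, b). a + b \<le> i + j}. ?t a b)"
    by (rule sum.triangle_reindex_eq[symmetric])
  also have "\<dots> = (\<Sum>(a, b)\<in>{..i} \<times> {..j}. ?t a b)"
  proof (rule sum.mono_neutral_right)
    show "finite {(a, b). a + b \<le> i + j}"
      by (rule finite_subset[of _ "{..i + j} \<times> {..i + j}"]) auto
    have "\<not> a \<le> i \<Longrightarrow> ?t a b = 0" "\<not> b \<le> j \<Longrightarrow> ?t a b = 0" for a b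
      by (simp_all add: startsby_zero_power_prefix[OF l])
    then show "\<forall>x\<in>{(a, b). a + b \<le> i + j} - {..i} \<times> {..j}. (case x of (a, b) \<Rightarrow> ?t a b) = 0"
      by auto
  qed auto
  finally show ?thesis
    by (simp add: sum.cartesian_product)
qed

text \<open>Both sides are the trinomial coefficient (a+b+c)! / (a! b! c!).\<close>

lemma multinomial_assoc:
  "((a + b) choose a) * ((c + (a + b)) choose c) = ((b + c) choose b) * ((a + (b + c)) choose a)"
proof -
  have eq: "fact a * fact b * fact c * (((a + b) choose a) * ((c + (a + b)) choose c)) = (fact (a + b + c) :: nat)"
    for a b c :: nat
    using binomial_fact_lemma[of a "a + b"] binomial_fact_lemma[of c "c + (a + b)"]
    by (simp add: ac_simps) (metis mult.assoc mult.commute)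
  have "fact a * fact b * fact c * (((a + b) choose a) * ((c + (a + b)) choose c))
      = fact a * fact b * fact c * (((b + c) choose b) * ((a + (b + c)) choose a) :: nat)"
    using eq[of a b c] eq[of b c a] by (simp add: ac_simps)
  then show ?thesis
    by simp
qed

text \<open>Both bracketings equal e(l(x) + l(y) + l(z)); expanded in powers of l(x), l(y), l(z),
  this has trinomial coefficients, which do not depend on the order of the variables.\<close>

lemma formal_group_law_of_logarithm:
  fixes l e :: "'a::field fps"
  assumes l: "fps_nth l 0 = 0" and e: "fps_nth e 0 = 0" and el: "e oo l = fps_X" and le: "l oo e = fps_X"
  shows "formal_group_law (compose_outer2 e (add2 l))"
proof -
  define G where "G = compose_outer2 e (add2 l)"
  note coeff = coeff2_compose_add2[OF l]
  have G0: "coeff2 G 0 0 = 0"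
    by (simp add: G_def compose_outer2_0_0 e)
  have sym: "coeff2 G i j = coeff2 G j i" for i j
  proof -
    let ?t = "\<lambda>i j a b. fps_nth e (a + b) * of_nat ((a + b) choose a) * fps_nth (l ^ a) i * fps_nth (l ^ b) j"
    have "?t i j a b = ?t j i b a" for a b
    proof -
      have "(a + b) choose a = (b + a) choose b"
        using binomial_symmetric[of a "a + b"] by (simp add: add.commute)
      then show ?thesis
        by (simp only: add.commute[of b a] mult.assoc mult.commute[of "fps_nth (l ^ a) i"])
    qed
    then have "(\<Sum>a\<le>i. \<Sum>b\<le>j. ?t i j a b) = (\<Sum>a\<le>i. \<Sum>b\<le>j. ?t j i b a)"
      by (rule sum.cong[OF refl sum.cong[OF refl]])
    also have "\<dots> = (\<Sum>b\<le>j. \<Sum>a\<le>i. ?t j i b a)"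
      by (rule sum.swap)
    finally show ?thesis
      unfolding G_def coeff .
  qed
  have left: "coeff2 G i 0 = fps_nth fps_X i" for i
  proof -
    have "coeff2 G i 0 = fps_nth (e oo l) i"
      unfolding G_def coeff fps_compose_nth by (simp add: atLeast0AtMost)
    then show ?thesis
      by (simp add: el)
  qed
  \<comment> \<open>Taylor expansion: e(T + Z) is the sum of \<open>Eb b\<close>(T) Z^b, so
    \<open>Eb b\<close> is the b-th divided derivative of e. With Z = l(z), the coefficient of z^k
    becomes a series in l(x), into which G is substituted through l(G) = l(x) + l(y).\<close>
  define Eb where "Eb b = Abs_fps (\<lambda>c. fps_nth e (c + b) * of_nat ((c + b) choose c))" for b
  have assoc: "coeff2 (compose_outer2 (Abs_fps (\<lambda>a. coeff2 G a k)) G) i j =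
      (\<Sum>b\<le>k. \<Sum>c\<le>i. \<Sum>d\<le>j. fps_nth e (b + (c + d)) *
        of_nat (((c + d) choose c) * ((b + (c + d)) choose b)) *
        (fps_nth (l ^ c) i * fps_nth (l ^ d) j * fps_nth (l ^ b) k))" for i j k
  proof -
    have A: "fps_nth (Abs_fps (\<lambda>a. coeff2 G a k)) a = (\<Sum>b\<le>k. fps_nth (l ^ b) k * fps_nth (Eb b oo l) a)" for a
    proof -
      have "fps_nth (Abs_fps (\<lambda>a. coeff2 G a k)) a = (\<Sum>b\<le>k. \<Sum>c\<le>a. fps_nth e (c + b) *
          of_nat ((c + b) choose c) * fps_nth (l ^ c) a * fps_nth (l ^ b) k)"
        unfolding G_def coeff fps_nth_Abs_fps by (rule sum.swap)
      also have "\<dots> = (\<Sum>b\<le>k. fps_nth (l ^ b) k * fps_nth (Eb b oo l) a)"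
        unfolding fps_compose_nth sum_distrib_left atLeast0AtMost
        by (intro sum.cong refl) (simp only: Eb_def fps_nth_Abs_fps ac_simps)
      finally show ?thesis .
    qed
    have EbG: "compose_outer2 (Eb b oo l) G = compose_outer2 (Eb b) (add2 l)" for b
    proof -
      have "compose_outer2 (Eb b oo l) G = compose_outer2 (Eb b) (compose_outer2 (l oo e) (add2 l))"
        unfolding G_def by (subst compose_outer2_compose[OF G0[unfolded G_def] l])
          (simp add: compose_outer2_compose[OF add2_0_0[OF l] e])
      then show ?thesis
        by (simp add: le compose_outer2_X add2_0_0[OF l])
    qed
    have "coeff2 (compose_outer2 (Abs_fps (\<lambda>a. coeff2 G a k)) G) i j
        = (\<Sum>b\<le>k. fps_nth (l ^ b) k * coeff2 (compose_outer2 (Eb b oo l) G) i j)"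
      unfolding compose_outer2_def coeff2_fps2 A sum_distrib_left sum_distrib_right
      by (subst sum.swap) (simp only: mult.assoc)
    also have "\<dots> =
      (\<Sum>b\<le>k. \<Sum>c\<le>i. \<Sum>d\<le>j. fps_nth e (b + (c + d)) *
        of_nat (((c + d) choose c) * ((b + (c + d)) choose b)) *
        (fps_nth (l ^ c) i * fps_nth (l ^ d) j * fps_nth (l ^ b) k))"
    proof (intro sum.cong refl)
      fix b
      have "(c + d + b) choose (c + d) = (b + (c + d)) choose b" for c d
        using binomial_symmetric[of b "b + (c + d)"] by (simp add: ac_simps)
      then show "fps_nth (l ^ b) k * coeff2 (compose_outer2 (Eb b oo l) G) i j =
        (\<Sum>c\<le>i. \<Sum>d\<le>j. fps_nth e (b + (c + d)) *
          of_nat (((c + d) choose c) * ((b + (c + d)) choose b)) *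
          (fps_nth (l ^ c) i * fps_nth (l ^ d) j * fps_nth (l ^ b) k))"
        unfolding EbG coeff sum_distrib_left
        by (intro sum.cong refl) (simp add: Eb_def ac_simps)
    qed
    finally show ?thesis .
  qed
  have "coeff2 (compose_outer2 (Abs_fps (\<lambda>a. coeff2 G a k)) G) i j
      = coeff2 (compose_outer2 (Abs_fps (\<lambda>b. coeff2 G i b)) G) j k" for i j k
  proof -
    let ?s = "\<lambda>b c d. fps_nth e (b + (c + d)) * of_nat (((c + d) choose c) * ((b + (c + d)) choose b)) *
        (fps_nth (l ^ c) i * fps_nth (l ^ d) j * fps_nth (l ^ b) k)"
    have "(\<Sum>b\<le>k. \<Sum>c\<le>i. \<Sum>d\<le>j. ?s b c d) = (\<Sum>c\<le>i. \<Sum>b\<le>k. \<Sum>d\<le>j. ?s b c d)"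
      by (rule sum.swap)
    also have "\<dots> = (\<Sum>c\<le>i. \<Sum>d\<le>j. \<Sum>b\<le>k. ?s b c d)"
      by (rule sum.cong[OF refl], rule sum.swap)
    also have "\<dots> = (\<Sum>c\<le>i. \<Sum>d\<le>j. \<Sum>b\<le>k. fps_nth e (c + (d + b)) *
        of_nat (((d + b) choose d) * ((c + (d + b)) choose c)) *
        (fps_nth (l ^ d) j * fps_nth (l ^ b) k * fps_nth (l ^ c) i))"
    proof (intro sum.cong refl)
      fix b c d
      show "?s b c d = fps_nth e (c + (d + b)) *
          of_nat (((d + b) choose d) * ((c + (d + b)) choose c)) *
          (fps_nth (l ^ d) j * fps_nth (l ^ b) k * fps_nth (l ^ c) i)"
        unfolding multinomial_assoc[of c d b] by (simp only: ac_simps)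
    qed
    finally show ?thesis
      unfolding assoc sym[of i] .
  qed
  then show ?thesis
    unfolding formal_group_law_def G_def[symmetric] using left sym by metis
qed

text \<open>Since l'(\<phi>) = l, both sides of the homomorphism equation equal e'(l(x) +
  l(y)).\<close>

lemma formal_group_hom_of_logarithms:
  fixes l e l' e' :: "'a::field fps"
  assumes l: "fps_nth l 0 = 0" and e: "fps_nth e 0 = 0" and le: "l oo e = fps_X"
    and l': "fps_nth l' 0 = 0" and e': "fps_nth e' 0 = 0" and le': "l' oo e' = fps_X"
  shows "formal_group_hom (compose_outer2 e (add2 l)) (compose_outer2 e' (add2 l')) (e' oo l)"
proof -
  define \<phi> where "\<phi> = e' oo l"
  have \<phi>0: "fps_nth \<phi> 0 = 0"
    by (simp add: \<phi>_def e')
  have l'\<phi>: "l' oo \<phi> = l"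
    unfolding \<phi>_def by (simp add: fps_compose_assoc[OF l e'] le' l)
  have "compose_outer2 \<phi> (compose_outer2 e (add2 l)) = compose_outer2 e' (compose_outer2 (l oo e) (add2 l))"
    unfolding \<phi>_def
    by (simp add: compose_outer2_compose[OF add2_0_0[OF l] e] compose_outer2_compose[OF _ l] compose_outer2_0_0 e)
  then have left: "compose_outer2 \<phi> (compose_outer2 e (add2 l)) = compose_outer2 e' (add2 l)"
    by (simp add: le compose_outer2_X add2_0_0[OF l])
  have pow: "(\<Sum>a\<le>i. fps_nth (l' ^ c) a * fps_nth (\<phi> ^ a) i) = fps_nth (l ^ c) i" for c i
  proof -
    have "(\<Sum>a\<le>i. fps_nth (l' ^ c) a * fps_nth (\<phi> ^ a) i) = fps_nth (l' ^ c oo \<phi>) i"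
      by (simp add: fps_compose_nth atLeast0AtMost)
    also have "l' ^ c oo \<phi> = l ^ c"
      by (simp add: l'\<phi> flip: fps_compose_power[OF \<phi>0])
    finally show ?thesis .
  qed
  have "compose_inner2 (compose_outer2 e' (add2 l')) \<phi> = compose_outer2 e' (add2 l)"
  proof (rule fps_fps_eqI)
    fix i j :: nat
    let ?w = "\<lambda>c d. fps_nth e' (c + d) * of_nat ((c + d) choose c)"
    have H: "coeff2 (compose_outer2 e' (add2 l')) a b =
        (\<Sum>c\<le>i. \<Sum>d\<le>j. ?w c d * fps_nth (l' ^ c) a * fps_nth (l' ^ d) b)" if "a \<le> i" "b \<le> j" for a b
    proof -
      have "(\<Sum>c\<le>a. \<Sum>d\<le>b. ?w c d * fps_nth (l' ^ c) a * fps_nth (l' ^ d) b)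
          = (\<Sum>c\<le>a. \<Sum>d\<le>j. ?w c d * fps_nth (l' ^ c) a * fps_nth (l' ^ d) b)"
        by (intro sum.cong refl sum.mono_neutral_left)
          (use that in \<open>auto simp: startsby_zero_power_prefix[OF l']\<close>)
      also have "\<dots> = (\<Sum>c\<le>i. \<Sum>d\<le>j. ?w c d * fps_nth (l' ^ c) a * fps_nth (l' ^ d) b)"
        by (intro sum.mono_neutral_left)
          (use that in \<open>auto simp: startsby_zero_power_prefix[OF l']\<close>)
      finally show ?thesis
        unfolding coeff2_compose_add2[OF l'] .
    qed
    have "coeff2 (compose_inner2 (compose_outer2 e' (add2 l')) \<phi>) i j =
        (\<Sum>a\<le>i. \<Sum>b\<le>j. \<Sum>c\<le>i. \<Sum>d\<le>j. ?w c d *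
          (fps_nth (l' ^ c) a * fps_nth (\<phi> ^ a) i) * (fps_nth (l' ^ d) b * fps_nth (\<phi> ^ b) j))"
      unfolding compose_inner2_def coeff2_fps2
      by (intro sum.cong refl) (simp add: H sum_distrib_left sum_distrib_right ac_simps)
    also have "\<dots> = (\<Sum>a\<le>i. \<Sum>c\<le>i. \<Sum>d\<le>j. \<Sum>b\<le>j. ?w c d *
          (fps_nth (l' ^ c) a * fps_nth (\<phi> ^ a) i) * (fps_nth (l' ^ d) b * fps_nth (\<phi> ^ b) j))"
      by (rule sum.cong[OF refl], rule trans[OF sum.swap], rule sum.cong[OF refl], rule sum.swap)
    also have "\<dots> = (\<Sum>c\<le>i. \<Sum>d\<le>j. \<Sum>a\<le>i. \<Sum>b\<le>j. ?w c d *
          (fps_nth (l' ^ c) a * fps_nth (\<phi> ^ a) i) * (fps_nth (l' ^ d) b * fps_nth (\<phi> ^ b) j))"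
      by (rule trans[OF sum.swap], rule sum.cong[OF refl], rule sum.swap)
    also have "\<dots> = (\<Sum>c\<le>i. \<Sum>d\<le>j. ?w c d * fps_nth (l ^ c) i * fps_nth (l ^ d) j)"
      by (simp only: pow flip: sum_distrib_left sum_distrib_right)
    also have "\<dots> = coeff2 (compose_outer2 e' (add2 l)) i j"
      by (rule coeff2_compose_add2[OF l, symmetric])
    finally show "coeff2 (compose_inner2 (compose_outer2 e' (add2 l')) \<phi>) i j =
      coeff2 (compose_outer2 e' (add2 l)) i j" .
  qed
  with left \<phi>0 show ?thesis
    by (simp add: formal_group_hom_def flip: \<phi>_def)
qed

section \<open>Frobenius congruences for power series\<close>

lemma of_nat_dvd_fps_iff:
  "(of_nat q :: 'a::comm_ring_1 fps) dvd f \<longleftrightarrow> (\<forall>n. of_nat q dvd fps_nth f n)"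
proof
  assume "of_nat q dvd f"
  then show "\<forall>n. of_nat q dvd fps_nth f n"
    by (auto elim!: dvdE simp flip: fps_of_nat)
next
  assume "\<forall>n. of_nat q dvd fps_nth f n"
  then have "\<forall>n. \<exists>b. fps_nth f n = of_nat q * b"
    unfolding dvd_def .
  from choice[OF this] obtain g where "\<And>n. fps_nth f n = of_nat q * g n"
    by blast
  then have "f = of_nat q * Abs_fps g"
    by (simp add: fps_eq_iff flip: fps_of_nat)
  then show "of_nat q dvd f"
    by (metis dvd_triv_left)
qed

lemma of_nat_dvd_coeff2:
  "(of_nat q :: 'a::comm_ring_1 fps fps) dvd G \<Longrightarrow> of_nat q dvd coeff2 G i j"
  by (simp add: of_nat_dvd_fps_iff coeff2_def)

lemma freshman_dream:
  assumes "prime q"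
  shows "of_nat q dvd (a + b :: 'a::comm_ring_1) ^ q - (a ^ q + b ^ q)"
proof -
  have q: "0 < q"
    using assms prime_gt_0_nat by blast
  let ?t = "\<lambda>k. of_nat (q choose k) * a ^ k * b ^ (q - k)"
  have "(a + b) ^ q = (\<Sum>k\<le>q. ?t k)"
    by (rule binomial_ring)
  also have "{..q} = insert 0 (insert q {0<..<q})"
    using q by auto
  also have "sum ?t \<dots> = b ^ q + (a ^ q + (\<Sum>k\<in>{0<..<q}. ?t k))"
    using q by simp
  finally have "(a + b) ^ q - (a ^ q + b ^ q) = (\<Sum>k\<in>{0<..<q}. ?t k)"
    by simp
  also have "of_nat q dvd \<dots>"
  proof (rule dvd_sum)
    fix k assume "k \<in> {0<..<q}"
    then have "q dvd (q choose k)"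
      using assms by (intro dvd_choose_prime) auto
    then show "of_nat q dvd ?t k"
      by (metis dvd_mult2 of_nat_mult dvdE dvd_triv_left)
  qed
  finally show ?thesis .
qed

text \<open>Splitting off the constant term and applying the freshman's dream lowers the index n by
  q. A general \<sigma> allows two uses: the identity on Z_p, and then x \<mapsto> x^p on the
  coefficient ring of series in x.\<close>

lemma fps_frobenius:
  fixes f :: "'a::comm_ring_1 fps"
  assumes q: "prime q" and \<sigma>: "\<And>a. of_nat q dvd a ^ q - \<sigma> a"
  shows "of_nat q dvd f ^ q - Abs_fps (\<lambda>n. if q dvd n then \<sigma> (fps_nth f (n div q)) else 0)"
proof -
  have q0: "0 < q"
    using q prime_gt_0_nat by blast
  have "of_nat q dvd fps_nth (f ^ q) n - (if q dvd n then \<sigma> (fps_nth f (n div q)) else 0)" for n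
  proof (induction n arbitrary: f rule: less_induct)
    case (less n)
    define s where "s = fps_shift 1 f"
    have "f = fps_const (fps_nth f 0) + fps_X * s"
      by (simp add: s_def fps_eq_iff)
    then have "of_nat q dvd f ^ q - (fps_const (fps_nth f 0) ^ q + (fps_X * s) ^ q)"
      using freshman_dream[OF q] by metis
    then have "of_nat q dvd fps_nth (f ^ q - (fps_const (fps_nth f 0) ^ q + (fps_X * s) ^ q)) n"
      by (simp only: of_nat_dvd_fps_iff)
    then have *: "of_nat q dvd fps_nth (f ^ q) n -
        ((if n = 0 then fps_nth f 0 ^ q else 0) + (if n < q then 0 else fps_nth (s ^ q) (n - q)))"
      by (simp add: power_mult_distrib fps_const_power fps_X_power_mult_nth)
    consider "n = 0" | "0 < n" "n < q" | "q \<le> n"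
      by linarith
    then have "of_nat q dvd ((if n = 0 then fps_nth f 0 ^ q else 0) + (if n < q then 0 else fps_nth (s ^ q) (n - q)))
        - (if q dvd n then \<sigma> (fps_nth f (n div q)) else 0)"
    proof cases
      case 3
      have "of_nat q dvd fps_nth (s ^ q) (n - q) - (if q dvd n - q then \<sigma> (fps_nth s ((n - q) div q)) else 0)"
        using 3 q0 by (intro less) simp
      moreover have "fps_nth s ((n - q) div q) = fps_nth f (n div q)"
        using 3 q0 by (simp add: s_def le_div_geq)
      ultimately show ?thesis
        using 3 q0 by (cases "q dvd n") (auto simp: dvd_minus_self)
    qed (use q0 \<sigma> in \<open>auto simp: nat_dvd_not_less\<close>)
    with * show ?case
      by (rule dvd_diff_trans)
  qed
  then show ?thesis
    by (simp add: of_nat_dvd_fps_iff)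
qed

text \<open>G(x^q, y^q), written as two substitutions in one variable so that multiplicativity is
  inherited from \<open>fps_compose\<close>.\<close>

definition frob2 :: "nat \<Rightarrow> 'a::idom fps fps \<Rightarrow> 'a fps fps" where
  "frob2 q G = Abs_fps (\<lambda>j. fps_nth G j oo fps_X ^ q) oo fps_X ^ q"

lemma coeff2_frob2:
  assumes "0 < q"
  shows "coeff2 (frob2 q G) i j = (if q dvd i \<and> q dvd j then coeff2 G (i div q) (j div q) else 0)"
  using assms by (simp add: frob2_def coeff2_def fps_nth_compose_X_power)

lemma frob2_power:
  assumes "0 < q"
  shows "frob2 q (G ^ k) = frob2 q G ^ k"
proof -
  let ?m = "\<lambda>G. Abs_fps (\<lambda>j. fps_nth G j oo fps_X ^ q) :: 'a fps fps"
  have m: "?m (G * H) = ?m G * ?m H" for G H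
    using assms by (simp add: fps_eq_iff fps_mult_nth fps_compose_sum_distrib fps_compose_mult_distrib)
  have mult: "frob2 q (G * H) = frob2 q G * frob2 q H" for G H :: "'a fps fps"
    unfolding frob2_def m using assms by (intro fps_compose_mult_distrib) simp
  have "?m 1 = 1"
    by (simp add: fps_eq_iff)
  then have one: "frob2 q 1 = (1 :: 'a fps fps)"
    by (simp add: frob2_def)
  show ?thesis
    by (induction k) (simp_all add: one mult)
qed

lemma padic_frobenius2:
  fixes G :: "'p::prime_card padic_int fps fps"
  shows "of_nat CARD('p) dvd G ^ CARD('p) - frob2 CARD('p) G"
proof -
  let ?q = "CARD('p)"
  have prime: "prime ?q"
    by (rule prime_card)
  have q: "0 < ?q"
    using prime prime_gt_0_nat by blast
  have "of_nat ?q dvd (f :: 'p padic_int fps) ^ ?q - (f oo fps_X ^ ?q)" for f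
  proof -
    have "of_nat ?q dvd f ^ ?q - Abs_fps (\<lambda>n. if ?q dvd n then id (fps_nth f (n div ?q)) else 0)"
      by (rule fps_frobenius[OF prime]) (simp add: padic_int_fermat)
    also have "Abs_fps (\<lambda>n. if ?q dvd n then id (fps_nth f (n div ?q)) else 0) = f oo fps_X ^ ?q"
      using q by (simp add: fps_eq_iff fps_nth_compose_X_power)
    finally show ?thesis .
  qed
  then have "of_nat ?q dvd G ^ ?q - Abs_fps (\<lambda>n. if ?q dvd n then fps_nth G (n div ?q) oo fps_X ^ ?q else 0)"
    by (rule fps_frobenius[OF prime])
  also have "Abs_fps (\<lambda>n. if ?q dvd n then fps_nth G (n div ?q) oo fps_X ^ ?q else 0) = frob2 ?q G"
    using q by (simp add: frob2_def fps_eq_iff fps_nth_compose_X_power)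
  finally show ?thesis .
qed

text \<open>For k = p^s m with m prime to p, raising to the power p^s gains s factors p, and m is a
  unit. The modulus p k is what cancels the denominators of \<alpha>/p and of the k-th coefficient
  of a logarithm.\<close>

lemma padic_power_diff2:
  fixes A B :: "'p::prime_card padic_int fps fps"
  assumes AB: "of_nat CARD('p) dvd A - B" and k: "0 < k"
  shows "of_nat (CARD('p) * k) dvd coeff2 (A ^ k) i j - coeff2 (B ^ k) i j"
proof -
  obtain s m where m: "k = CARD('p) ^ s * m" "\<not> CARD('p) dvd m"
    using multiplicity_decompose'[of k "CARD('p)"] k prime_gt_1_nat[OF prime_card[where 'a = 'p]]
    by (metis not_prime_unit prime_card neq0_conv mult.commute)
  have "of_nat CARD('p) ^ Suc s dvd A ^ CARD('p) ^ s - B ^ CARD('p) ^ s"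
    by (rule power_dvd_diff_power_power[OF AB])
  then have "of_nat CARD('p) ^ Suc s dvd (A ^ CARD('p) ^ s) ^ m - (B ^ CARD('p) ^ s) ^ m"
    by (rule dvd_diff_power)
  then have "of_nat (CARD('p) ^ Suc s) dvd A ^ k - B ^ k"
    by (simp add: m(1) power_mult)
  then have "of_nat (CARD('p) ^ Suc s) dvd coeff2 (A ^ k - B ^ k) i j"
    by (rule of_nat_dvd_coeff2)
  then obtain t where t: "coeff2 (A ^ k) i j - coeff2 (B ^ k) i j = of_nat (CARD('p) ^ Suc s) * t"
    by (auto elim: dvdE)
  have "of_nat m * uinv (of_nat m) = (1 :: 'p padic_int)"
    using m(2) by (intro mult_uinv padic_int_unit) (simp add: CARD_dvd_of_nat_iff)
  then have "coeff2 (A ^ k) i j - coeff2 (B ^ k) i j = of_nat (CARD('p) ^ Suc s) * (of_nat m * uinv (of_nat m)) * t"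
    by (simp add: t)
  also have "\<dots> = of_nat (CARD('p) * k) * (uinv (of_nat m) * t)"
    by (simp add: m(1) ac_simps)
  finally show ?thesis
    by (metis dvd_triv_left)
qed

section \<open>Power series with \<open>p\<close>-adically integral coefficients\<close>

definition emb1 :: "'p::prime_card padic_int fps \<Rightarrow> 'p padic fps" where
  "emb1 f = Abs_fps (\<lambda>n. of_padic_int (fps_nth f n))"

definition emb2 :: "'p::prime_card padic_int fps fps \<Rightarrow> 'p padic fps fps" where
  "emb2 G = fps2 (\<lambda>i j. of_padic_int (coeff2 G i j))"

lemma emb1_nth [simp]: "fps_nth (emb1 f) n = of_padic_int (fps_nth f n)"
  by (simp add: emb1_def)

lemma coeff2_emb2 [simp]: "coeff2 (emb2 G) i j = of_padic_int (coeff2 G i j)"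
  by (simp add: emb2_def)

lemma emb1_eq_iff: "emb1 f = emb1 g \<longleftrightarrow> f = g"
  by (simp add: fps_eq_iff)

lemma emb2_eq_iff: "emb2 G = emb2 H \<longleftrightarrow> G = H"
  by (metis coeff2_emb2 fps_fps_eqI of_padic_int_eq_iff)

lemma emb1_mult: "emb1 (f * g) = emb1 f * emb1 g"
  by (simp add: fps_eq_iff fps_mult_nth)

lemma emb1_power: "emb1 (f ^ n) = emb1 f ^ n"
proof (induction n)
  case (Suc n)
  then show ?case by (simp add: emb1_mult)
qed (simp add: fps_eq_iff)

lemma emb2_mult: "emb2 (G * H) = emb2 G * emb2 H"
  by (rule fps_fps_eqI) (simp add: coeff2_mult)

lemma emb2_power: "emb2 (G ^ n) = emb2 G ^ n"
proof (induction n)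
  case (Suc n)
  then show ?case by (simp add: emb2_mult)
qed (simp add: coeff2_1 fps_fps_eqI)

lemma emb1_compose: "emb1 (f oo g) = emb1 f oo emb1 g"
  by (simp add: fps_eq_iff fps_compose_nth flip: emb1_power)

lemma emb2_compose_outer2: "emb2 (compose_outer2 f G) = compose_outer2 (emb1 f) (emb2 G)"
  by (rule fps_fps_eqI) (simp add: compose_outer2_def flip: emb2_power)

lemma emb2_compose_inner2: "emb2 (compose_inner2 G f) = compose_inner2 (emb2 G) (emb1 f)"
  by (rule fps_fps_eqI) (simp add: compose_inner2_def flip: emb1_power)

lemma formal_group_law_emb2:
  assumes "formal_group_law (emb2 G)"
  shows "formal_group_law G"
proof -
  have X: "fps_nth fps_X i = of_padic_int (fps_nth fps_X i)" for i
    by simp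
  have A: "Abs_fps (\<lambda>a. of_padic_int (f a)) = emb1 (Abs_fps f)" for f :: "nat \<Rightarrow> 'a padic_int"
    by (simp add: fps_eq_iff)
  show ?thesis
    using assms unfolding formal_group_law_def coeff2_emb2 A emb2_compose_outer2[symmetric] X
      of_padic_int_eq_iff .
qed

lemma formal_group_hom_emb2:
  assumes "formal_group_hom (emb2 G) (emb2 H) (emb1 f)"
  shows "formal_group_hom G H f"
  using assms unfolding formal_group_hom_def
  by (simp add: emb2_eq_iff flip: emb2_compose_outer2 emb2_compose_inner2)

section \<open>The functional equation lemma\<close>

text \<open>The last clause says that \<open>l(\<tau>) - (\<alpha>/p) l(\<tau>^p)\<close> is integral.\<close>

definition functional_equation :: "'p::prime_card padic_int \<Rightarrow> 'p padic fps \<Rightarrow> bool" where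
  "functional_equation \<alpha> l \<longleftrightarrow> fps_nth l 0 = 0 \<and> fps_nth l 1 = 1 \<and>
     (\<forall>k. of_nat k * fps_nth l k \<in> range of_padic_int) \<and>
     (\<forall>k. fps_nth l k -
        (if CARD('p) dvd k then of_padic_int \<alpha> / of_nat CARD('p) * fps_nth l (k div CARD('p)) else 0)
        \<in> range of_padic_int)"

lemma range_of_padic_int_closed:
  "x \<in> range of_padic_int \<Longrightarrow> y \<in> range of_padic_int \<Longrightarrow> x + y \<in> range (of_padic_int :: 'p::prime_card padic_int \<Rightarrow> _)"
  "x \<in> range of_padic_int \<Longrightarrow> y \<in> range of_padic_int \<Longrightarrow> x - y \<in> range (of_padic_int :: 'p::prime_card padic_int \<Rightarrow> _)"
  "x \<in> range of_padic_int \<Longrightarrow> y \<in> range of_padic_int \<Longrightarrow> x * y \<in> range (of_padic_int :: 'p::prime_card padic_int \<Rightarrow> _)"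
  by (auto simp flip: of_padic_int_simps)

lemma range_of_padic_int_sum:
  "(\<And>x. x \<in> A \<Longrightarrow> f x \<in> range of_padic_int) \<Longrightarrow> sum f A \<in> range (of_padic_int :: 'p::prime_card padic_int \<Rightarrow> _)"
proof (induction A rule: infinite_finite_induct)
  case (insert x F)
  then show ?case by (simp add: range_of_padic_int_closed)
qed (auto simp flip: of_padic_int_simps(1))

text \<open>A coefficient of degree at least n in one factor meets k others of degree at least 1.
  Hence the unknown top-degree coefficients of \<open>u\<close> enter its higher powers only in
  higher degree.\<close>

lemma coeff2_power_cong:
  fixes u v :: "'a::comm_ring_1 fps fps"
  assumes u: "coeff2 u 0 0 = 0" and v: "coeff2 v 0 0 = 0"
    and uv: "\<And>a b. a + b < n \<Longrightarrow> coeff2 u a b = coeff2 v a b"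
  shows "i + j < n + k \<Longrightarrow> coeff2 (u ^ Suc k) i j = coeff2 (v ^ Suc k) i j"
proof (induction k arbitrary: i j)
  case (Suc k)
  have "coeff2 u a b * coeff2 (u ^ Suc k) (i - a) (j - b) = coeff2 v a b * coeff2 (v ^ Suc k) (i - a) (j - b)"
    if "a \<le> i" "b \<le> j" for a b
  proof -
    consider "a = 0" "b = 0" | "0 < a + b" "a + b < n" | "n \<le> a + b" "0 < a + b"
      by linarith
    then show ?thesis
    proof cases
      case 1
      then show ?thesis by (simp add: u v)
    next
      case 2
      then have "(i - a) + (j - b) < n + k"
        using that Suc.prems by linarith
      then show ?thesis
        using 2 Suc.IH uv by simp
    next
      case 3
      then have "(i - a) + (j - b) < Suc k"
        using that Suc.prems by linarith
      then show ?thesis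
        by (simp only: coeff2_power_eq_0[OF u] coeff2_power_eq_0[OF v] mult_zero_right)
    qed
  qed
  then show ?case
    unfolding power_Suc[of _ "Suc k"] coeff2_mult by (intro sum.cong refl) simp
qed (use uv in simp)

text \<open>Induction on the total degree n. The top coefficient of \<open>u\<close> is that of l(u)
  minus contributions of lower ones. Subtracting the Frobenius transform leaves terms with integral
  \<open>g k\<close>, and (\<alpha>/p) l_k times the difference of the k-th powers of v^p and
  \<open>frob2\<close> of v; that difference is divisible by p k.\<close>

lemma functional_equation_lemma:
  fixes l :: "'p::prime_card padic fps" and u :: "'p padic fps fps"
  assumes l: "functional_equation \<alpha> l" and u: "coeff2 u 0 0 = 0"
    and w: "\<And>i j. coeff2 (compose_outer2 l u) i j -
      (if CARD('p) dvd i \<and> CARD('p) dvd j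
       then of_padic_int \<alpha> / of_nat CARD('p) *
         coeff2 (compose_outer2 l u) (i div CARD('p)) (j div CARD('p)) else 0)
      \<in> range of_padic_int"
  obtains G where "emb2 G = u"
proof -
  let ?q = "CARD('p)" and ?w = "compose_outer2 l u" and ?O = "range (of_padic_int :: 'p padic_int \<Rightarrow> _)"
  let ?\<beta> = "of_padic_int \<alpha> / of_nat ?q :: 'p padic"
  have q1: "1 < ?q"
    by (rule prime_gt_1_nat[OF prime_card])
  have "coeff2 u i j \<in> ?O" if "i + j = n" for i j n
    using that
  proof (induction n arbitrary: i j rule: less_induct)
    case (less n)
    show ?case
    proof (cases "n = 0")
      case True
      then show ?thesis
        using less.prems u by (simp flip: of_padic_int_simps(1))
    next
      case False
      have "\<forall>a b. \<exists>c. a + b < n \<longrightarrow> coeff2 u a b = of_padic_int c"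
        using less.IH by blast
      then obtain c where c: "\<And>a b. a + b < n \<Longrightarrow> coeff2 u a b = of_padic_int (c a b)"
        by metis
      define v where "v = fps2 (\<lambda>a b. if a + b < n then c a b else 0)"
      have v: "coeff2 u a b = coeff2 (emb2 v) a b" if "a + b < n" for a b
        using that by (simp add: v_def c)
      have v0: "coeff2 v 0 0 = 0"
        using v[of 0 0] False u by simp
      have v0': "coeff2 (emb2 v) 0 0 = 0"
        by (simp add: v0)
      have pow: "coeff2 (u ^ Suc k) a b = of_padic_int (coeff2 (v ^ Suc k) a b)" if "a + b < n + k" for a b k
        using coeff2_power_cong[OF u v0' v that] by (simp only: flip: emb2_power coeff2_emb2)
      have "coeff2 ?w i j = (\<Sum>k\<le>n. fps_nth l k * coeff2 (u ^ k) i j)"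
        using u less.prems by (intro coeff2_compose_outer2) simp_all
      \<comment> \<open>\<open>v\<close> vanishes in degree n, so the coefficient of
        \<open>u\<close> stands alone at k = 1; for k \<ge> 2 only lower coefficients enter.\<close>
      also have "\<dots> = (\<Sum>k\<le>n. (if k = 1 then coeff2 u i j else 0) + fps_nth l k * of_padic_int (coeff2 (v ^ k) i j))"
      proof (rule sum.cong)
        fix k
        consider "k = 0" | "k = 1" | k' where "k = Suc (Suc k')"
          by (metis One_nat_def not0_implies_Suc)
        then show "fps_nth l k * coeff2 (u ^ k) i j =
          (if k = 1 then coeff2 u i j else 0) + fps_nth l k * of_padic_int (coeff2 (v ^ k) i j)"
        proof cases
          case 1
          then show ?thesis
            using l by (simp add: functional_equation_def)
        next
          case 2
          then show ?thesis
            using l less.prems by (simp add: functional_equation_def v_def)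
        next
          case 3
          then show ?thesis
            using pow[of i j "Suc k'"] less.prems by simp
        qed
      qed simp
      finally have w_eq: "coeff2 ?w i j = coeff2 u i j + (\<Sum>k\<le>n. fps_nth l k * of_padic_int (coeff2 (v ^ k) i j))"
        using False by (simp add: sum.distrib)
      \<comment> \<open>Degree n/p lies below n, where \<open>v\<close> already agrees with
        \<open>u\<close>.\<close>
      have w_frob: "(if ?q dvd i \<and> ?q dvd j then ?\<beta> * coeff2 ?w (i div ?q) (j div ?q) else 0) =
          ?\<beta> * (\<Sum>k\<le>n. fps_nth l k * of_padic_int (coeff2 (frob2 ?q v ^ k) i j))"
      proof (cases "?q dvd i \<and> ?q dvd j")
        case True
        have "i div ?q + j div ?q = n div ?q"
          using True less.prems by (metis div_plus_div_distrib_dvd_left)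
        then have small: "i div ?q + j div ?q < n"
          using False q1 by simp
        have "coeff2 ?w (i div ?q) (j div ?q) = (\<Sum>k\<le>n. fps_nth l k * coeff2 (u ^ k) (i div ?q) (j div ?q))"
          using u small by (intro coeff2_compose_outer2) simp_all
        also have "\<dots> = (\<Sum>k\<le>n. fps_nth l k * of_padic_int (coeff2 (frob2 ?q v ^ k) i j))"
        proof (rule sum.cong)
          fix k
          show "fps_nth l k * coeff2 (u ^ k) (i div ?q) (j div ?q) =
            fps_nth l k * of_padic_int (coeff2 (frob2 ?q v ^ k) i j)"
          proof (cases k)
            case 0
            then show ?thesis
              using l by (simp add: functional_equation_def)
          next
            case (Suc k')
            then show ?thesis
              using True small q1 pow[of "i div ?q" "j div ?q" k']
              by (simp add: coeff2_frob2 del: power_Suc flip: frob2_power)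
          qed
        qed simp
        finally show ?thesis
          using True by simp
      next
        case False
        then have "coeff2 (frob2 ?q v ^ k) i j = 0" for k
          using q1 by (auto simp: coeff2_frob2 simp flip: frob2_power)
        then show ?thesis
          unfolding if_not_P[OF False] by simp
      qed
      define g where "g k = fps_nth l k - (if ?q dvd k then ?\<beta> * fps_nth l (k div ?q) else 0)" for k
      have g: "g k \<in> ?O" for k
        using l by (simp add: functional_equation_def g_def)
      have "(\<Sum>k\<le>n. (if ?q dvd k then ?\<beta> * fps_nth l (k div ?q) else 0) * of_padic_int (coeff2 (v ^ k) i j))
          = (\<Sum>k\<in>(\<lambda>k. ?q * k) ` {..n}. ?\<beta> * fps_nth l (k div ?q) * of_padic_int (coeff2 (v ^ k) i j))"
      proof (rule sum.mono_neutral_cong)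
        show "\<And>k. k \<in> {..n} - (\<lambda>k. ?q * k) ` {..n} \<Longrightarrow>
          (if ?q dvd k then ?\<beta> * fps_nth l (k div ?q) else 0) * of_padic_int (coeff2 (v ^ k) i j) = 0"
        proof -
          fix k assume k: "k \<in> {..n} - (\<lambda>k. ?q * k) ` {..n}"
          have "\<not> ?q dvd k"
          proof
            assume "?q dvd k"
            then obtain k' where "k = ?q * k'" ..
            moreover have "k' \<le> ?q * k'"
              using q1 by simp
            ultimately have "k' \<le> n"
              using k by (metis DiffD1 atMost_iff le_trans)
            with \<open>k = ?q * k'\<close> k show False
              by blast
          qed
          then show "(if ?q dvd k then ?\<beta> * fps_nth l (k div ?q) else 0) * of_padic_int (coeff2 (v ^ k) i j) = 0"
            by simp
        qed
        show "\<And>k. k \<in> (\<lambda>k. ?q * k) ` {..n} - {..n} \<Longrightarrow>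
          ?\<beta> * fps_nth l (k div ?q) * of_padic_int (coeff2 (v ^ k) i j) = 0"
          using less.prems by (simp add: coeff2_power_eq_0[OF v0] del: atMost_iff) (auto simp: coeff2_power_eq_0[OF v0])
      qed auto
      also have "\<dots> = ?\<beta> * (\<Sum>k\<le>n. fps_nth l k * of_padic_int (coeff2 ((v ^ ?q) ^ k) i j))"
        using q1 by (subst sum.reindex) (auto simp: inj_on_def sum_distrib_left power_mult mult.assoc)
      finally have l_sum: "(\<Sum>k\<le>n. fps_nth l k * of_padic_int (coeff2 (v ^ k) i j)) =
          (\<Sum>k\<le>n. g k * of_padic_int (coeff2 (v ^ k) i j)) +
          ?\<beta> * (\<Sum>k\<le>n. fps_nth l k * of_padic_int (coeff2 ((v ^ ?q) ^ k) i j))"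
        by (simp add: g_def left_diff_distrib sum_subtractf)
      have "coeff2 u i j = (coeff2 ?w i j - ?\<beta> * (\<Sum>k\<le>n. fps_nth l k * of_padic_int (coeff2 (frob2 ?q v ^ k) i j)))
          - (\<Sum>k\<le>n. g k * of_padic_int (coeff2 (v ^ k) i j))
          - (\<Sum>k\<le>n. ?\<beta> * fps_nth l k * of_padic_int (coeff2 ((v ^ ?q) ^ k) i j - coeff2 (frob2 ?q v ^ k) i j))"
        using w_eq unfolding l_sum by (simp add: sum_distrib_left sum_subtractf algebra_simps)
      also have "\<dots> \<in> ?O"
      proof (rule range_of_padic_int_closed(2)[OF range_of_padic_int_closed(2)
            [OF _ range_of_padic_int_sum] range_of_padic_int_sum])
        show "coeff2 ?w i j - ?\<beta> * (\<Sum>k\<le>n. fps_nth l k * of_padic_int (coeff2 (frob2 ?q v ^ k) i j)) \<in> ?O"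
          using w[of i j] unfolding w_frob .
        fix k
        show "g k * of_padic_int (coeff2 (v ^ k) i j) \<in> ?O"
          using g by (intro range_of_padic_int_closed(3)) auto
        show "?\<beta> * fps_nth l k * of_padic_int (coeff2 ((v ^ ?q) ^ k) i j - coeff2 (frob2 ?q v ^ k) i j) \<in> ?O"
        proof (cases "k = 0")
          case True
          then show ?thesis
            using rangeI[of "of_padic_int :: 'p padic_int \<Rightarrow> _" 0] by simp
        next
          case k: False
          then obtain t where t: "coeff2 ((v ^ ?q) ^ k) i j - coeff2 (frob2 ?q v ^ k) i j = of_nat (?q * k) * t"
            using padic_power_diff2[OF padic_frobenius2] by (metis dvdE neq0_conv)
          obtain b where b: "of_nat k * fps_nth l k = of_padic_int b"
            using l unfolding functional_equation_def by blast
          have "?\<beta> * fps_nth l k * of_padic_int (of_nat (?q * k) * t) =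
              of_padic_int \<alpha> * (of_nat k * fps_nth l k) * of_padic_int t"
            using q1 by simp
          also have "\<dots> = of_padic_int (\<alpha> * b * t)"
            unfolding b by simp
          finally show ?thesis
            unfolding t by (rule range_eqI)
        qed
      qed
      finally show ?thesis .
    qed
  qed
  then have "\<forall>i j. \<exists>c. coeff2 u i j = of_padic_int c"
    by blast
  then obtain c where "\<And>i j. coeff2 u i j = of_padic_int (c i j)"
    by metis
  then have "emb2 (fps2 c) = u"
    by (intro fps_fps_eqI) simp
  then show ?thesis
    by (rule that)
qed

section \<open>Formal groups of height one\<close>

lemma functional_equation_inverse:
  fixes l :: "'p::prime_card padic fps"
  assumes "functional_equation \<alpha> l"
  shows "fps_nth l 0 = 0" "fps_nth (fps_inv l) 0 = 0" "l oo fps_inv l = fps_X" "fps_inv l oo l = fps_X"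
  using assms fps_inv[of l] fps_inv_right[of l] by (auto simp: functional_equation_def fps_inv_def)

text \<open>l(G) = l(x) + l(y) has only pure powers of x or of y, so it inherits the functional
  equation from \<open>l\<close>.\<close>

lemma functional_equation_formal_group:
  fixes l :: "'p::prime_card padic fps"
  assumes l: "functional_equation \<alpha> l"
  obtains G where "emb2 G = compose_outer2 (fps_inv l) (add2 l)"
    "formal_group_law G" "formal_group_log G l"
proof -
  note inv = functional_equation_inverse[OF l]
  let ?G = "compose_outer2 (fps_inv l) (add2 l)"
  have log: "compose_outer2 l ?G = add2 l"
    by (simp add: inv compose_outer2_X add2_0_0 flip: compose_outer2_compose)
  have zero: "0 \<in> range (of_padic_int :: 'p padic_int \<Rightarrow> _)"
    by (simp flip: of_padic_int_simps(1))
  obtain G where G: "emb2 G = ?G"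
  proof (rule functional_equation_lemma[OF l])
    show "coeff2 ?G 0 0 = 0"
      by (simp add: compose_outer2_0_0 inv)
    fix i j :: nat
    let ?q = "CARD('p)"
    let ?g = "\<lambda>k. fps_nth l k - (if ?q dvd k then of_padic_int \<alpha> / of_nat ?q * fps_nth l (k div ?q) else 0)"
    have g: "?g k \<in> range of_padic_int" for k
      using l by (simp add: functional_equation_def)
    have "coeff2 (add2 l) i j - (if ?q dvd i \<and> ?q dvd j then of_padic_int \<alpha> / of_nat ?q *
        coeff2 (add2 l) (i div ?q) (j div ?q) else 0) =
        (if i = 0 then ?g j else 0) + (if j = 0 then ?g i else 0)"
      using inv(1) by (auto simp: add2_def dvd_div_eq_0_iff)
    also have "\<dots> \<in> range of_padic_int"
      using g zero by (intro range_of_padic_int_closed) auto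
    finally show "coeff2 (compose_outer2 l ?G) i j -
        (if ?q dvd i \<and> ?q dvd j then of_padic_int \<alpha> / of_nat ?q *
          coeff2 (compose_outer2 l ?G) (i div ?q) (j div ?q) else 0) \<in> range of_padic_int"
      unfolding log .
  qed
  show ?thesis
  proof (rule that[OF G])
    have "formal_group_law ?G"
      by (rule formal_group_law_of_logarithm) (fact inv)+
    then show "formal_group_law G"
      by (intro formal_group_law_emb2) (simp add: G)
    show "formal_group_log G l"
      using l log by (simp add: formal_group_log_def functional_equation_def G[unfolded emb2_def] add2_def)
  qed
qed

lemma coeff2_fps_const: "coeff2 (fps_const f) i j = (if j = 0 then fps_nth f i else 0)"
  by (simp add: coeff2_def)

text \<open>A series in x is viewed as constant in y. Applying \<open>l'\<close> to it gives
  \<open>l\<close>, so the functional equation of \<open>l\<close>, with the same \<alpha>, is the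
  hypothesis that the lemma for \<open>l'\<close> requires.\<close>

lemma functional_equation_hom:
  fixes l l' :: "'p::prime_card padic fps"
  assumes l: "functional_equation \<alpha> l" and l': "functional_equation \<alpha> l'"
  obtains f where "emb1 f = fps_inv l' oo l"
proof -
  note inv = functional_equation_inverse[OF l] and inv' = functional_equation_inverse[OF l']
  let ?f = "fps_inv l' oo l"
  have const: "compose_outer2 a (fps_const b) = fps_const (a oo b)" if "fps_nth b 0 = 0" for a b :: "'p padic fps"
  proof (rule fps_fps_eqI)
    fix i j :: nat
    show "coeff2 (compose_outer2 a (fps_const b)) i j = coeff2 (fps_const (a oo b)) i j"
      by (cases "j = 0")
        (simp_all add: compose_outer2_def fps_const_power coeff2_fps_const fps_compose_nth atLeast0AtMost)
  qed
  have "l' oo ?f = l"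
    by (simp add: fps_compose_assoc inv inv')
  then have log: "compose_outer2 l' (fps_const ?f) = fps_const l"
    by (simp add: const inv')
  obtain G where G: "emb2 G = fps_const ?f"
  proof (rule functional_equation_lemma[OF l'])
    show "coeff2 (fps_const ?f) 0 0 = 0"
      by (simp add: coeff2_fps_const inv')
    fix i j :: nat
    let ?q = "CARD('p)"
    show "coeff2 (compose_outer2 l' (fps_const ?f)) i j -
        (if ?q dvd i \<and> ?q dvd j then of_padic_int \<alpha> / of_nat ?q *
          coeff2 (compose_outer2 l' (fps_const ?f)) (i div ?q) (j div ?q) else 0) \<in> range of_padic_int"
      unfolding log
    proof (cases "j = 0")
      case True
      then show "coeff2 (fps_const l) i j - (if ?q dvd i \<and> ?q dvd j then of_padic_int \<alpha> / of_nat ?q *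
          coeff2 (fps_const l) (i div ?q) (j div ?q) else 0) \<in> range of_padic_int"
        using l[unfolded functional_equation_def, THEN conjunct2, THEN conjunct2, THEN conjunct2, rule_format, of i]
        by (cases "?q dvd i") (simp_all add: coeff2_fps_const)
    next
      case False
      then show "coeff2 (fps_const l) i j - (if ?q dvd i \<and> ?q dvd j then of_padic_int \<alpha> / of_nat ?q *
          coeff2 (fps_const l) (i div ?q) (j div ?q) else 0) \<in> range of_padic_int"
        using rangeI[of "of_padic_int :: 'p padic_int \<Rightarrow> _" 0]
        by (auto simp: coeff2_fps_const dvd_div_eq_0_iff)
    qed
  qed
  have "emb1 (Abs_fps (\<lambda>i. coeff2 G i 0)) = ?f"
    using arg_cong[OF G, of "\<lambda>G. coeff2 G _ 0"]
    by (simp add: fps_eq_iff coeff2_fps_const)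
  then show ?thesis
    by (rule that)
qed

lemma functional_equation_isomorphic:
  fixes l l' :: "'p::prime_card padic fps"
  assumes l: "functional_equation \<alpha> l" and l': "functional_equation \<alpha> l'"
  obtains G H where "formal_group_law G" "formal_group_log G l"
    "formal_group_law H" "formal_group_log H l'" "formal_group_isomorphic G H"
proof -
  note inv = functional_equation_inverse[OF l] and inv' = functional_equation_inverse[OF l']
  obtain G where G: "emb2 G = compose_outer2 (fps_inv l) (add2 l)"
    "formal_group_law G" "formal_group_log G l"
    by (rule functional_equation_formal_group[OF l])
  obtain H where H: "emb2 H = compose_outer2 (fps_inv l') (add2 l')"
    "formal_group_law H" "formal_group_log H l'"
    by (rule functional_equation_formal_group[OF l'])
  obtain f where f: "emb1 f = fps_inv l' oo l"
    by (rule functional_equation_hom[OF l l'])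
  obtain f' where f': "emb1 f' = fps_inv l oo l'"
    by (rule functional_equation_hom[OF l' l])
  have "formal_group_hom G H f"
    by (rule formal_group_hom_emb2, unfold G(1) H(1) f, rule formal_group_hom_of_logarithms)
      (fact inv inv')+
  moreover have "formal_group_hom H G f'"
    by (rule formal_group_hom_emb2, unfold G(1) H(1) f', rule formal_group_hom_of_logarithms)
      (fact inv inv')+
  moreover have "(fps_inv a oo b) oo (fps_inv b oo a) = fps_X"
    if "functional_equation \<alpha> a" "functional_equation \<alpha> b" for a b :: "'p padic fps"
  proof -
    note ia = functional_equation_inverse[OF that(1)] and ib = functional_equation_inverse[OF that(2)]
    have "b oo (fps_inv b oo a) = a"
      by (simp add: fps_compose_assoc ia ib)
    moreover have "fps_nth (fps_inv b oo a) 0 = 0"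
      by (simp add: ib)
    ultimately show ?thesis
      using fps_compose_assoc[of "fps_inv b oo a" b "fps_inv a"] ia ib by metis
  qed
  then have "emb1 (f oo f') = fps_X" "emb1 (f' oo f) = fps_X"
    using l l' by (simp_all add: emb1_compose f f')
  moreover have "emb1 fps_X = (fps_X :: 'p padic fps)"
    by (simp add: fps_eq_iff)
  ultimately have "formal_group_isomorphic G H"
    unfolding formal_group_isomorphic_def by (metis emb1_eq_iff)
  with G H show ?thesis
    using that by blast
qed

text \<open>At odd k = m p^(s+1) with p not dividing m, the coefficient is a difference as in the
  congruence, divided by k: p^(s+1) cancels and m is a unit. If p does not divide k, then k itself
  is a unit.\<close>

lemma functional_equation_odd_log_series:
  fixes a :: "nat \<Rightarrow> 'p::prime_card padic_int"
  assumes p: "odd CARD('p)" and a0: "a 0 = 1"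
    and a: "\<And>m s. odd m \<Longrightarrow> padic_p ^ Suc s dvd
      a ((m * CARD('p) ^ Suc s - 1) div 2) - \<alpha> * a ((m * CARD('p) ^ s - 1) div 2)"
  shows "functional_equation \<alpha> (odd_log_series (\<lambda>n. of_padic_int (a n)))"
proof -
  let ?q = "CARD('p)" and ?l = "odd_log_series (\<lambda>n. of_padic_int (a n))"
  let ?O = "range (of_padic_int :: 'p padic_int \<Rightarrow> _)"
  have q1: "1 < ?q"
    by (rule prime_gt_1_nat[OF prime_card])
  have l: "fps_nth ?l k = (if odd k then of_padic_int (a (k div 2)) / of_nat k else 0)" for k
    by (simp add: odd_log_series_def)
  have zero: "0 \<in> ?O"
    by (simp flip: of_padic_int_simps(1))
  have inv: "1 / of_nat m \<in> ?O" if "\<not> ?q dvd m" for m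
  proof -
    have "of_nat m * uinv (of_nat m) = (1 :: 'p padic_int)"
      using that by (intro mult_uinv padic_int_unit) (simp add: CARD_dvd_of_nat_iff)
    then have "of_padic_int (of_nat m * uinv (of_nat m)) = (1 :: 'p padic)"
      by simp
    then have "1 / of_nat m = of_padic_int (uinv (of_nat m :: 'p padic_int))"
      by (metis mult_zero_left nonzero_mult_div_cancel_left of_padic_int_simps(6,7) zero_neq_one)
    then show ?thesis
      by blast
  qed
  have "of_nat k * fps_nth ?l k \<in> ?O" for k
    using zero by (cases "k = 0") (auto simp: l)
  moreover have "fps_nth ?l k - (if ?q dvd k then of_padic_int \<alpha> / of_nat ?q * fps_nth ?l (k div ?q) else 0) \<in> ?O" for k
  proof (cases "odd k")
    case False
    have "even (k div ?q)" if "?q dvd k"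
      using False that p by (metis dvd_mult_div_cancel even_mult_iff)
    then show ?thesis
      using False zero by (simp add: l)
  next
    case odd: True
    show ?thesis
    proof (cases "?q dvd k")
      case False
      have "of_padic_int (a (k div 2)) * (1 / of_nat k) \<in> ?O"
        using inv[OF False] by (intro range_of_padic_int_closed(3)) auto
      then show ?thesis
        using odd False by (simp add: l)
    next
      case True
      have "k \<noteq> 0"
        using odd by (metis even_zero)
      then obtain s m where "k = ?q ^ s * m" "\<not> ?q dvd m"
        using multiplicity_decompose'[of k ?q] q1 by (metis mult.commute nat_dvd_1_iff_1 nat_neq_iff)
      with True obtain s' where m: "k = m * ?q ^ Suc s'" "\<not> ?q dvd m"
        by (cases s) (auto simp: mult.commute)
      have "odd m"
        using odd unfolding m(1) by simp
      from a[OF this, of s'] obtain t where t: "a ((k - 1) div 2) - \<alpha> * a ((m * ?q ^ s' - 1) div 2) = padic_p ^ Suc s' * t"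
        unfolding m(1) by (auto elim: dvdE)
      have k': "k div ?q = m * ?q ^ s'" "odd (m * ?q ^ s')"
        using q1 \<open>odd m\<close> p by (simp_all add: m(1))
      have half: "n div 2 = (n - 1) div 2" if "odd n" for n :: nat
        using that by (auto elim: oddE)
      have "m \<noteq> 0"
        using \<open>odd m\<close> by (metis even_zero)
      have "fps_nth ?l k - of_padic_int \<alpha> / of_nat ?q * fps_nth ?l (k div ?q) =
          of_padic_int (a ((k - 1) div 2) - \<alpha> * a ((m * ?q ^ s' - 1) div 2)) / of_nat (m * ?q ^ Suc s')"
        using odd k' q1 \<open>m \<noteq> 0\<close> by (simp add: l half field_simps) (simp add: m(1))
      also have "\<dots> = of_padic_int t * (1 / of_nat m)"
        unfolding t using q1 \<open>m \<noteq> 0\<close> by simp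
      also have "\<dots> \<in> ?O"
        using inv[OF m(2)] by (intro range_of_padic_int_closed(3)) auto
      finally show ?thesis
        using True by simp
    qed
  qed
  moreover have "fps_nth ?l 0 = 0" "fps_nth ?l 1 = 1"
    by (simp_all add: l a0)
  ultimately show ?thesis
    by (simp add: functional_equation_def)
qed

theorem theorem6:
  fixes r p :: nat and lam :: "'p::prime_card padic_int"
  defines "p \<equiv> CARD('p)"
  defines "F \<equiv> F_trunc r (of_padic_int lam)"
  assumes "r \<ge> 1" and "odd p"
    and "\<not> padic_cong (F ((p - 1) div 2)) 0 1"
  shows "(\<exists>\<alpha> :: 'p padic_int. \<alpha> dvd 1 \<and>
           (\<forall>s m. s \<ge> 1 \<and> odd m \<longrightarrow>
              padic_cong (F ((m * p ^ s - 1) div 2) / F ((m * p ^ (s - 1) - 1) div 2))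
                (of_padic_int \<alpha>)
                (ereal (real s) - (SUP t. padic_ord (F ((m * p ^ t - 1) div 2)))))) \<and>
         (\<exists>G H :: 'p padic_int fps fps.
            formal_group_law G \<and> formal_group_log G (odd_log_series F) \<and>
            formal_group_law H \<and>
            formal_group_log H (odd_log_series (stienstra_coeff r (of_padic_int lam))) \<and>
            formal_group_isomorphic G H)"
proof -
  \<comment> \<open>Oddness of p makes 2 a unit, so -1/2 lies in Z_p.\<close>
  have two: "\<not> CARD('p) dvd 2"
    using \<open>odd p\<close> prime_card[where 'a = 'p] unfolding p_def
    by (metis dvd_refl primes_dvd_imp_eq two_is_prime_nat)
  have "of_nat 2 * uinv (of_nat 2) = (1 :: 'p padic_int)"
    using two by (intro mult_uinv padic_int_unit, unfold CARD_dvd_of_nat_iff)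
  then have y: "2 * (- uinv 2) = (- 1 :: 'p padic_int)"
    by simp
  obtain A where A: "binomial_seq (- uinv 2 :: 'p padic_int) A"
    by (rule binomial_seq_exists)
  define z where "z = (- 1) ^ r * lam"
  define f where "f N = (\<Sum>k\<le>N. A k ^ r * z ^ k)" for N
  define b where "b N = (\<Sum>k\<le>N. of_nat (N choose k) ^ r * z ^ k)" for N
  have F: "F = (\<lambda>N. of_padic_int (f N))"
    unfolding F_def f_def z_def using F_trunc_eq[OF y A] by blast
  have B: "stienstra_coeff r (of_padic_int lam) = (\<lambda>N. of_padic_int (b N))"
    unfolding b_def z_def using stienstra_coeff_eq[OF \<open>r \<ge> 1\<close>] by blast
  have "\<not> padic_p dvd f ((CARD('p) - 1) div 2)"
    using assms(5) padic_cong_0_1_of_dvd unfolding F p_def by blast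
  from truncated_sum_congruences[OF \<open>odd p\<close>[unfolded p_def] \<open>r \<ge> 1\<close> y A this[unfolded f_def],
      folded f_def b_def]
  obtain \<alpha> where \<alpha>: "\<alpha> dvd 1"
    and f: "\<And>m s. odd m \<Longrightarrow> padic_p ^ Suc s dvd
      f ((m * CARD('p) ^ Suc s - 1) div 2) - \<alpha> * f ((m * CARD('p) ^ s - 1) div 2)"
    and b: "\<And>m s. odd m \<Longrightarrow> padic_p ^ Suc s dvd
      b ((m * CARD('p) ^ Suc s - 1) div 2) - \<alpha> * b ((m * CARD('p) ^ s - 1) div 2)"
    by blast
  \<comment> \<open>The denominator is the member t = s - 1 of the supremum, hence its valuation is
    at most d_m.\<close>
  have "padic_cong (F ((m * p ^ s - 1) div 2) / F ((m * p ^ (s - 1) - 1) div 2)) (of_padic_int \<alpha>)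
      (ereal (real s) - (SUP t. padic_ord (F ((m * p ^ t - 1) div 2))))" if "s \<ge> 1" "odd m" for s m
    unfolding F
  proof (rule padic_cong_divide)
    show "padic_p ^ s dvd f ((m * p ^ s - 1) div 2) - \<alpha> * f ((m * p ^ (s - 1) - 1) div 2)"
      using f[OF that(2), of "s - 1"] that(1) by (simp add: p_def)
    show "padic_ord (of_padic_int (f ((m * p ^ (s - 1) - 1) div 2))) \<le>
        (SUP t. padic_ord (of_padic_int (f ((m * p ^ t - 1) div 2))))"
      by (rule SUP_upper) simp
  qed
  moreover have "A 0 = 1"
    using A by (auto simp: binomial_seq_def dest: spec[of _ 0])
  then have "f 0 = 1" "b 0 = 1"
    by (simp_all add: f_def b_def)
  then have "functional_equation \<alpha> (odd_log_series F)"
    "functional_equation \<alpha> (odd_log_series (stienstra_coeff r (of_padic_int lam)))"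
    unfolding F B using \<open>odd p\<close>[unfolded p_def] f b
    by (blast intro: functional_equation_odd_log_series)+
  then obtain G H where "formal_group_law G" "formal_group_log G (odd_log_series F)"
    "formal_group_law H" "formal_group_log H (odd_log_series (stienstra_coeff r (of_padic_int lam)))"
    "formal_group_isomorphic G H"
    by (rule functional_equation_isomorphic)
  ultimately show ?thesis
    using \<alpha> by blast
qed

end
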